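(* Let $m,n\ge1$ be integers. The second homology group of the $2$-orbit abelian quandle $U_{m,n}$ is $$H_2(U_{m,n})\cong\mathbb{Z}^4\oplus\mathbb{Z}_{\gcd(m,n)}^2.$$ In particular, its torsion groups both coincide with the whole parameter group: $T_1\cong T_2\cong G'(U_{m,n})$.
   Context: $\mathbb{Z}_k$ is the cyclic group of order $k$. A quandle is a set $X$ with a binary operation $\triangleleft$ such that for all $a,b,c$: $(a\triangleleft b)\triangleleft c=(a\triangleleft c)\triangleleft(b\triangleleft c)$; the right translation $-\triangleleft b$ is a bijection of $X$ (with inverse $-\mathbin{\widetilde{\triangleleft}}b$); $a\triangleleft a=a$. Its orbits are the orbits under the group generated by all right translations. It is abelian if $(a\triangleleft b)\triangleleft c=(a\triangleleft c)\triangleleft b$ for all $a,b,c$. Its structure group is $G=G(X,\triangleleft)=\langle g_a,\ a\in X\mid g_ag_b=g_bg_{a\triangleleft b}\rangle$, acting on $X$ on the right by $a\cdot g_b=a\triangleleft b$. The quandle $U_{m,n}$: the set $\{x_0,\ldots,x_{m-1},y_0,\ldots,y_{n-1}\}$ with $x_i\triangleleft x_j=x_i$, $y_k\triangleleft y_l=y_k$, $x_i\triangleleft y_k=x_{i+1}$, $y_k\triangleleft x_i=y_{k+1}$ (indices of $x$ modulo $m$, of $y$ modulo $n$). Its orbits are $O_1=\{x_i\}$, $O_2=\{y_k\}$. Parameter group: for $U_{m,n}$ it is $G'(U_{m,n})=\langle x^{(1)}_1,x^{(2)}_1\mid (x^{(1)}_1)^m=(x^{(2)}_1)^n=1,\ x^{(1)}_1x^{(2)}_1=1\rangle$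 (commuting generators), isomorphic to $\mathbb{Z}_{\gcd(m,n)}$. Rack homology: $C_k=\mathbb{Z}X^k$, $d_k(a_1,\ldots,a_k)=\sum_{i=2}^k(-1)^{i-1}[(a_1,\ldots,\widehat{a_i},\ldots,a_k)-(a_1\triangleleft a_i,\ldots,a_{i-1}\triangleleft a_i,a_{i+1},\ldots,a_k)]$; so $d_2(a,b)=a\triangleleft b-a$, $d_3(a,b,c)=(a\triangleleft b,c)-(a,c)-(a\triangleleft c,b\triangleleft c)+(a,b)$, $H_2=\ker d_2/\operatorname{im}d_3$. The complex splits as a direct sum over orbits of the subcomplexes $C_{k;i}=\mathbb{Z}(O_i\times X^{k-1})$; let $Q_{2;i}=C_{2;i}/d_3(C_{3;i})$ and let $H_{2;i}\subseteq Q_{2;i}$ be the corresponding summand of $H_2$. Torsion groups: the path maps $p_a\colon G\to Q_{2;i}$ ($a\in O_i$) are the maps determined by $p_a(g_b)=(a,b)$, $p_a(g_b^{-1})=-(a\mathbin{\widetilde{\triangleleft}}b,b)$ and $p_a(gg')=p_a(g)+p_{a\cdot g}(g')$; they restrict to group morphisms from the stabiliser $G_a$ to $H_{2;i}$. For a finite abelian quandle, $[G,G]\subseteq G_a$, and the $i$-th torsion group is $T_i=p_a([G,G])\subseteq H_{2;i}$ for any $a\in O_i$ (independent of the choice of $a$). *)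

theory Defs
  imports "HOL-Algebra.Free_Abelian_Groups" "HOL-Algebra.Generated_Groups" "HOL-Algebra.Bij"
begin

section \<open>Groups given by generators and relations\<close>

text \<open>A word over \<open>S\<close> is a list of letters; \<open>(s, True)\<close> stands for the generator \<open>s\<close> and
  \<open>(s, False)\<close> for its formal inverse. A relation \<open>u = v\<close> is a pair of words.\<close>

type_synonym 'a word = "('a \<times> bool) list"

definition words :: "'a set \<Rightarrow> 'a word set" where
  "words S = lists (S \<times> UNIV)"

inductive pres_eq :: "'a set \<Rightarrow> ('a word \<times> 'a word) set \<Rightarrow> 'a word \<Rightarrow> 'a word \<Rightarrow> bool"
  for S :: "'a set" and R :: "('a word \<times> 'a word) set" where
  refl: "u \<in> words S \<Longrightarrow> pres_eq S R u u"
| sym: "pres_eq S R u v \<Longrightarrow> pres_eq S R v u"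
| trans: "pres_eq S R u v \<Longrightarrow> pres_eq S R v w \<Longrightarrow> pres_eq S R u w"
| append: "pres_eq S R u u' \<Longrightarrow> pres_eq S R v v' \<Longrightarrow> pres_eq S R (u @ v) (u' @ v')"
| cancel: "s \<in> S \<Longrightarrow> pres_eq S R [(s, e), (s, \<not> e)] []"
| rel: "(u, v) \<in> R \<Longrightarrow> u \<in> words S \<Longrightarrow> v \<in> words S \<Longrightarrow> pres_eq S R u v"

definition pres_class :: "'a set \<Rightarrow> ('a word \<times> 'a word) set \<Rightarrow> 'a word \<Rightarrow> 'a word set" where
  "pres_class S R u = {v. pres_eq S R u v}"

definition presented_group :: "'a set \<Rightarrow> ('a word \<times> 'a word) set \<Rightarrow> 'a word set monoid" where
  "presented_group S R =
     \<lparr>carrier = pres_class S R ` words S,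
      monoid.mult = (\<lambda>A B. \<Union>u\<in>A. \<Union>v\<in>B. pres_class S R (u @ v)),
      one = pres_class S R []\<rparr>"

lemma pres_eq_words: "pres_eq S R u v \<Longrightarrow> u \<in> words S \<and> v \<in> words S"
  by (induction rule: pres_eq.induct) (auto simp: words_def)

lemma pres_class_eq_iff:
  assumes "u \<in> words S"
  shows "pres_class S R u = pres_class S R v \<longleftrightarrow> pres_eq S R u v"
  unfolding pres_class_def set_eq_iff mem_Collect_eq
  using assms by (meson pres_eq.refl pres_eq.sym pres_eq.trans)

lemma mult_pres_class:
  assumes "u \<in> words S" "v \<in> words S"
  shows "pres_class S R u \<otimes>\<^bsub>presented_group S R\<^esub> pres_class S R v = pres_class S R (u @ v)"
  using assms unfolding presented_group_def pres_class_def
  by (auto intro: pres_eq.append pres_eq.refl pres_eq.trans)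

lemma pres_eq_inverse:
  "u \<in> words S \<Longrightarrow> pres_eq S R (map (\<lambda>(s, e). (s, \<not> e)) (rev u) @ u) []"
proof (induction u)
  case Nil
  show ?case by (simp add: pres_eq.refl words_def)
next
  case (Cons l u)
  obtain s e where l: "l = (s, e)" by force
  have s: "s \<in> S" and u: "u \<in> words S" using Cons.prems l by (auto simp: words_def)
  let ?i = "map (\<lambda>(s, e). (s, \<not> e)) (rev u)"
  have i: "?i \<in> words S" using u by (auto simp: words_def)
  have "pres_eq S R ([(s, \<not> e), (s, e)] @ u) ([] @ u)"
    using pres_eq.cancel[OF s, of R "\<not> e"] by (intro pres_eq.append pres_eq.refl u) simp_all
  then have "pres_eq S R (?i @ [(s, \<not> e), (s, e)] @ u) (?i @ u)"
    by (intro pres_eq.append pres_eq.refl i) simp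
  with Cons.IH[OF u] show ?case using l by (auto intro: pres_eq.trans)
qed

lemma group_presented_group: "group (presented_group S R)"
proof (rule groupI)
  let ?G = "presented_group S R"
  have app: "u @ v \<in> words S" if "u \<in> words S" "v \<in> words S" for u v
    using that by (auto simp: words_def)
  have nil: "[] \<in> words S" by (simp add: words_def)
  have car: "carrier ?G = pres_class S R ` words S" and one: "\<one>\<^bsub>?G\<^esub> = pres_class S R []"
    by (simp_all add: presented_group_def)
  show "x \<otimes>\<^bsub>?G\<^esub> y \<in> carrier ?G" if "x \<in> carrier ?G" "y \<in> carrier ?G" for x y
    using that by (auto simp: car mult_pres_class app)
  show "\<one>\<^bsub>?G\<^esub> \<in> carrier ?G" by (auto simp: car one nil)
  show "x \<otimes>\<^bsub>?G\<^esub> y \<otimes>\<^bsub>?G\<^esub> z = x \<otimes>\<^bsub>?G\<^esub> (y \<otimes>\<^bsub>?G\<^esub> z)"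
    if "x \<in> carrier ?G" "y \<in> carrier ?G" "z \<in> carrier ?G" for x y z
    using that by (auto simp: car mult_pres_class app)
  show "\<one>\<^bsub>?G\<^esub> \<otimes>\<^bsub>?G\<^esub> x = x" if "x \<in> carrier ?G" for x
    using that by (auto simp: car one mult_pres_class nil)
  show "\<exists>y\<in>carrier ?G. y \<otimes>\<^bsub>?G\<^esub> x = \<one>\<^bsub>?G\<^esub>" if x: "x \<in> carrier ?G" for x
  proof -
    obtain u where u: "u \<in> words S" "x = pres_class S R u" using x by (auto simp: car)
    let ?v = "map (\<lambda>(s, e). (s, \<not> e)) (rev u)"
    have v: "?v \<in> words S" using u by (auto simp: words_def)
    have "pres_class S R ?v \<otimes>\<^bsub>?G\<^esub> x = \<one>\<^bsub>?G\<^esub>"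
      using u v pres_eq_inverse[OF u(1)]
      by (simp add: one mult_pres_class app pres_class_eq_iff)
    then show ?thesis using v by (auto simp: car)
  qed
qed


section \<open>Quandles\<close>

locale quandle =
  fixes X :: "'a set" and qop :: "'a \<Rightarrow> 'a \<Rightarrow> 'a"
  assumes self_distrib: "\<lbrakk>a \<in> X; b \<in> X; c \<in> X\<rbrakk> \<Longrightarrow> qop (qop a b) c = qop (qop a c) (qop b c)"
    and bij_right_translation: "b \<in> X \<Longrightarrow> bij_betw (\<lambda>a. qop a b) X X"
    and idem: "a \<in> X \<Longrightarrow> qop a a = a"

locale abelian_quandle = quandle +
  assumes abelian: "\<lbrakk>a \<in> X; b \<in> X; c \<in> X\<rbrakk> \<Longrightarrow> qop (qop a b) c = qop (qop a c) b"

definition qop_inv :: "'a set \<Rightarrow> ('a \<Rightarrow> 'a \<Rightarrow> 'a) \<Rightarrow> 'a \<Rightarrow> 'a \<Rightarrow> 'a" where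
  "qop_inv X qop a b = inv_into X (\<lambda>x. qop x b) a"

definition right_translation :: "'a set \<Rightarrow> ('a \<Rightarrow> 'a \<Rightarrow> 'a) \<Rightarrow> 'a \<Rightarrow> 'a \<Rightarrow> 'a" where
  "right_translation X qop b = restrict (\<lambda>a. qop a b) X"

definition quandle_orbit :: "'a set \<Rightarrow> ('a \<Rightarrow> 'a \<Rightarrow> 'a) \<Rightarrow> 'a \<Rightarrow> 'a set" where
  "quandle_orbit X qop a = {f a | f. f \<in> generate (BijGroup X) (right_translation X qop ` X)}"

definition structure_rels :: "'a set \<Rightarrow> ('a \<Rightarrow> 'a \<Rightarrow> 'a) \<Rightarrow> ('a word \<times> 'a word) set" where
  "structure_rels X qop =
     {([(a, True), (b, True)], [(b, True), (qop a b, True)]) | a b. a \<in> X \<and> b \<in> X}"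

definition structure_group :: "'a set \<Rightarrow> ('a \<Rightarrow> 'a \<Rightarrow> 'a) \<Rightarrow> 'a word set monoid" where
  "structure_group X qop = presented_group X (structure_rels X qop)"

definition structure_gen :: "'a set \<Rightarrow> ('a \<Rightarrow> 'a \<Rightarrow> 'a) \<Rightarrow> 'a \<Rightarrow> 'a word set" where
  "structure_gen X qop a = pres_class X (structure_rels X qop) [(a, True)]"

text \<open>The right action of the structure group on \<open>X\<close> determined by its values on the generators;
  \<open>structure_action X qop a g\<close> is \<open>a \<cdot> g\<close>.\<close>

definition structure_action ::
  "'a set \<Rightarrow> ('a \<Rightarrow> 'a \<Rightarrow> 'a) \<Rightarrow> 'a \<Rightarrow> 'a word set \<Rightarrow> 'a" where
  "structure_action X qop = (let G = structure_group X qop in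
     THE act. act \<in> X \<rightarrow>\<^sub>E carrier G \<rightarrow>\<^sub>E X
       \<and> (\<forall>a\<in>X. act a \<one>\<^bsub>G\<^esub> = a)
       \<and> (\<forall>a\<in>X. \<forall>g\<in>carrier G. \<forall>h\<in>carrier G. act a (g \<otimes>\<^bsub>G\<^esub> h) = act (act a g) h)
       \<and> (\<forall>a\<in>X. \<forall>b\<in>X. act a (structure_gen X qop b) = qop a b))"


section \<open>Rack homology\<close>

text \<open>Tuples are lists, so the entry \<open>a\<^sub>i\<close> of \<open>xs = [a\<^sub>1, \<dots>, a\<^sub>k]\<close> is \<open>xs ! (i - 1)\<close>.\<close>

definition rack_chains :: "'a set \<Rightarrow> nat \<Rightarrow> ('a list \<Rightarrow>\<^sub>0 int) monoid" where
  "rack_chains X k = free_Abelian_group {xs. length xs = k \<and> set xs \<subseteq> X}"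

definition rack_boundary :: "('a \<Rightarrow> 'a \<Rightarrow> 'a) \<Rightarrow> ('a list \<Rightarrow>\<^sub>0 int) \<Rightarrow> ('a list \<Rightarrow>\<^sub>0 int)" where
  "rack_boundary qop = frag_extend (\<lambda>xs. \<Sum>i = 2..length xs. frag_cmul ((- 1) ^ (i - 1))
     (frag_of (take (i - 1) xs @ drop i xs)
      - frag_of (map (\<lambda>a. qop a (xs ! (i - 1))) (take (i - 1) xs) @ drop i xs)))"

definition rack_homology ::
  "'a set \<Rightarrow> ('a \<Rightarrow> 'a \<Rightarrow> 'a) \<Rightarrow> nat \<Rightarrow> ('a list \<Rightarrow>\<^sub>0 int) set monoid" where
  "rack_homology X qop k =
     (rack_chains X k)\<lparr>carrier := kernel (rack_chains X k) (rack_chains X (k - 1)) (rack_boundary qop)\<rparr>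
       Mod (rack_boundary qop ` carrier (rack_chains X (k + 1)))"

text \<open>The subcomplex \<open>\<int>(Y \<times> X\<^bsup>k-1\<^esup>)\<close> belonging to an orbit \<open>Y\<close>, in degrees \<open>k \<ge> 1\<close>.\<close>

definition orbit_chains :: "'a set \<Rightarrow> 'a set \<Rightarrow> nat \<Rightarrow> ('a list \<Rightarrow>\<^sub>0 int) monoid" where
  "orbit_chains X Y k = free_Abelian_group {a # xs | a xs. a \<in> Y \<and> length xs = k - 1 \<and> set xs \<subseteq> X}"

definition Q2_group ::
  "'a set \<Rightarrow> ('a \<Rightarrow> 'a \<Rightarrow> 'a) \<Rightarrow> 'a set \<Rightarrow> ('a list \<Rightarrow>\<^sub>0 int) set monoid" where
  "Q2_group X qop Y = orbit_chains X Y 2 Mod (rack_boundary qop ` carrier (orbit_chains X Y 3))"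

definition Q2_class ::
  "'a set \<Rightarrow> ('a \<Rightarrow> 'a \<Rightarrow> 'a) \<Rightarrow> 'a set \<Rightarrow> ('a list \<Rightarrow>\<^sub>0 int) \<Rightarrow> ('a list \<Rightarrow>\<^sub>0 int) set" where
  "Q2_class X qop Y c = (rack_boundary qop ` carrier (orbit_chains X Y 3)) #>\<^bsub>orbit_chains X Y 2\<^esub> c"

definition H2_summand ::
  "'a set \<Rightarrow> ('a \<Rightarrow> 'a \<Rightarrow> 'a) \<Rightarrow> 'a set \<Rightarrow> ('a list \<Rightarrow>\<^sub>0 int) set monoid" where
  "H2_summand X qop Y = (Q2_group X qop Y)
     \<lparr>carrier := Q2_class X qop Y ` kernel (orbit_chains X Y 2) (orbit_chains X Y 1) (rack_boundary qop)\<rparr>"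


section \<open>Path maps and torsion groups\<close>

text \<open>\<open>path_map X qop a\<close> is \<open>p\<^sub>a\<close>. The abelian groups \<open>Q\<^sub>2\<close> carry the multiplicative notation of
  their HOL-Algebra records. All maps are extensional, which makes the family unique.\<close>

definition path_map ::
  "'a set \<Rightarrow> ('a \<Rightarrow> 'a \<Rightarrow> 'a) \<Rightarrow> 'a \<Rightarrow> 'a word set \<Rightarrow> ('a list \<Rightarrow>\<^sub>0 int) set" where
  "path_map X qop =
    (let G = structure_group X qop;
         Q = (\<lambda>a. Q2_group X qop (quandle_orbit X qop a));
         cls = (\<lambda>a b. Q2_class X qop (quandle_orbit X qop a) (frag_of [a, b]))
     in THE p. p \<in> (\<Pi>\<^sub>E a\<in>X. carrier G \<rightarrow>\<^sub>E carrier (Q a))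
       \<and> (\<forall>a\<in>X. \<forall>b\<in>X. p a (structure_gen X qop b) = cls a b)
       \<and> (\<forall>a\<in>X. \<forall>b\<in>X. p a (inv\<^bsub>G\<^esub> structure_gen X qop b) = inv\<^bsub>Q a\<^esub> cls (qop_inv X qop a b) b)
       \<and> (\<forall>a\<in>X. \<forall>g\<in>carrier G. \<forall>h\<in>carrier G.
            p a (g \<otimes>\<^bsub>G\<^esub> h) = p a g \<otimes>\<^bsub>Q a\<^esub> p (structure_action X qop a g) h))"

text \<open>The torsion group of the orbit of \<open>a\<close>, computed at the base point \<open>a\<close>.\<close>

definition torsion_group ::
  "'a set \<Rightarrow> ('a \<Rightarrow> 'a \<Rightarrow> 'a) \<Rightarrow> 'a \<Rightarrow> ('a list \<Rightarrow>\<^sub>0 int) set monoid" where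
  "torsion_group X qop a = (let G = structure_group X qop in
     (H2_summand X qop (quandle_orbit X qop a))
       \<lparr>carrier := path_map X qop a ` derived G (carrier G)\<rparr>)"


section \<open>The quandles \<open>U\<^bsub>m,n\<^esub>\<close>\<close>

text \<open>\<open>Inl i\<close> is \<open>x\<^sub>i\<close> and \<open>Inr k\<close> is \<open>y\<^sub>k\<close>.\<close>

definition U_orbit1 :: "nat \<Rightarrow> (nat + nat) set" where
  "U_orbit1 m = Inl ` {..<m}"

definition U_orbit2 :: "nat \<Rightarrow> (nat + nat) set" where
  "U_orbit2 n = Inr ` {..<n}"

definition U_set :: "nat \<Rightarrow> nat \<Rightarrow> (nat + nat) set" where
  "U_set m n = U_orbit1 m \<union> U_orbit2 n"

fun U_op :: "nat \<Rightarrow> nat \<Rightarrow> nat + nat \<Rightarrow> nat + nat \<Rightarrow> nat + nat" where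
  "U_op m n (Inl i) (Inl j) = Inl i"
| "U_op m n (Inr k) (Inr l) = Inr k"
| "U_op m n (Inl i) (Inr k) = Inl ((i + 1) mod m)"
| "U_op m n (Inr k) (Inl i) = Inr ((k + 1) mod n)"

text \<open>The generators \<open>1\<close> and \<open>2\<close> stand for \<open>x\<^sup>(\<^sup>1\<^sup>)\<^sub>1\<close> and \<open>x\<^sup>(\<^sup>2\<^sup>)\<^sub>1\<close>; the last relation makes them
  commute.\<close>

definition U_parameter_group :: "nat \<Rightarrow> nat \<Rightarrow> nat word set monoid" where
  "U_parameter_group m n = presented_group {1, 2}
     {(replicate m (1, True), []), (replicate n (2, True), []),
      ([(1, True), (2, True)], []), ([(1, True), (2, True)], [(2, True), (1, True)])}"


subsection \<open>Sanity checks\<close>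

lemma rack_boundary_2: "rack_boundary qop (frag_of [a, b]) = frag_of [qop a b] - frag_of [a]"
  by (simp add: rack_boundary_def)

lemma rack_boundary_3:
  "rack_boundary qop (frag_of [a, b, c]) =
     frag_of [qop a b, c] - frag_of [a, c] - frag_of [qop a c, qop b c] + frag_of [a, b]"
  by (simp add: rack_boundary_def numeral_3_eq_3 numeral_2_eq_2)

lemma bij_betw_Suc_mod:
  assumes "(m::nat) \<ge> 1" shows "bij_betw (\<lambda>i. (i + 1) mod m) {..<m} {..<m}"
proof -
  have "inj_on (\<lambda>i. (i + 1) mod m) {..<m}"
    by (rule inj_onI) (auto simp: mod_Suc split: if_splits)
  moreover have "(\<lambda>i. (i + 1) mod m) ` {..<m} \<subseteq> {..<m}" using assms by auto
  ultimately show ?thesis by (simp add: bij_betw_def endo_inj_surj)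
qed

lemma bij_betw_U_op:
  assumes "m \<ge> 1" "n \<ge> 1"
  shows "bij_betw (\<lambda>a. U_op m n a b) (U_orbit1 m) (U_orbit1 m)"
    and "bij_betw (\<lambda>a. U_op m n a b) (U_orbit2 n) (U_orbit2 n)"
proof -
  have conj: "bij_betw f (h ` S) (h ` S)"
    if "inj h" "bij_betw g S S" "\<And>i. f (h i) = h (g i)"
    for h :: "nat \<Rightarrow> nat + nat" and f g S
  proof -
    have "f ` h ` S = h ` g ` S" by (simp add: image_image that(3))
    moreover have "inj_on f (h ` S)"
      using that by (fastforce simp: inj_on_def inj_def bij_betw_def)
    ultimately show ?thesis using that(2) by (simp add: bij_betw_def)
  qed
  show "bij_betw (\<lambda>a. U_op m n a b) (U_orbit1 m) (U_orbit1 m)"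
    unfolding U_orbit1_def
    by (cases b) (auto intro: conj[of _ id] conj[OF _ bij_betw_Suc_mod[OF assms(1)]])
  show "bij_betw (\<lambda>a. U_op m n a b) (U_orbit2 n) (U_orbit2 n)"
    unfolding U_orbit2_def
    by (cases b) (auto intro: conj[of _ id] conj[OF _ bij_betw_Suc_mod[OF assms(2)]])
qed

lemma U_abelian_quandle:
  assumes "m \<ge> 1" "n \<ge> 1" shows "abelian_quandle (U_set m n) (U_op m n)"
proof
  fix a b c
  show "U_op m n (U_op m n a b) c = U_op m n (U_op m n a c) (U_op m n b c)"
    by (cases a; cases b; cases c) auto
  show "U_op m n a a = a" by (cases a) auto
  show "U_op m n (U_op m n a b) c = U_op m n (U_op m n a c) b"
    by (cases a; cases b; cases c) auto
  show "bij_betw (\<lambda>a. U_op m n a b) (U_set m n) (U_set m n)"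
    unfolding U_set_def using assms
    by (intro bij_betw_combine bij_betw_U_op) (auto simp: U_orbit1_def U_orbit2_def)
qed

lemma U_orbits:
  assumes "m \<ge> 1" "n \<ge> 1"
  shows "a \<in> U_orbit1 m \<Longrightarrow> quandle_orbit (U_set m n) (U_op m n) a = U_orbit1 m"
    and "a \<in> U_orbit2 n \<Longrightarrow> quandle_orbit (U_set m n) (U_op m n) a = U_orbit2 n"
proof -
  interpret U: abelian_quandle "U_set m n" "U_op m n" by (rule U_abelian_quandle[OF assms])
  let ?X = "U_set m n" let ?B = "BijGroup ?X" let ?t = "right_translation ?X (U_op m n)"
  let ?gen = "generate ?B (?t ` ?X)"
  interpret B: group ?B by (rule group_BijGroup)
  have t: "?t b \<in> carrier ?B" if "b \<in> ?X" for b
    using U.bij_right_translation[OF that]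
    by (auto simp: BijGroup_def Bij_def right_translation_def cong: bij_betw_cong)
  have incl: "f a \<in> Y" if "f \<in> ?gen" "a \<in> Y" "Y \<subseteq> ?X"
    and Y: "\<And>b. bij_betw (\<lambda>a. U_op m n a b) Y Y" for f a Y
    using that(1,2)
  proof (induction arbitrary: a rule: generate.induct)
    case one
    then show ?case using \<open>Y \<subseteq> ?X\<close> by (auto simp: BijGroup_def)
  next
    case (incl h)
    then obtain b where "b \<in> ?X" "h = ?t b" by auto
    moreover have "U_op m n a b \<in> Y" using bij_betwE[OF Y] incl.prems by blast
    ultimately show ?case using \<open>Y \<subseteq> ?X\<close> incl.prems by (auto simp: right_translation_def)
  next
    case (inv h)
    then obtain b where b: "b \<in> ?X" "h = ?t b" by auto
    obtain c where c: "c \<in> Y" "U_op m n c b = a" using inv.prems bij_betw_imp_surj_on[OF Y[of b]]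
      by (metis imageE)
    have hB: "h \<in> Bij ?X" using t[OF b(1)] b(2) by (simp add: BijGroup_def)
    have "h c = a" using b c \<open>Y \<subseteq> ?X\<close> by (auto simp: right_translation_def)
    moreover have "inj_on h ?X" using hB by (auto simp: Bij_def bij_betw_def)
    ultimately have "inv_into ?X h a = c" using c \<open>Y \<subseteq> ?X\<close> by (auto intro: inv_into_f_eq)
    then show ?case using c inv.prems \<open>Y \<subseteq> ?X\<close> by (auto simp: inv_BijGroup[OF hB])
  next
    case (eng h1 h2)
    have "h1 \<in> Bij ?X" "h2 \<in> Bij ?X"
      using eng.hyps B.generate_in_carrier[of "?t ` ?X"] t by (auto simp: BijGroup_def)
    then show ?case using eng.IH eng.prems \<open>Y \<subseteq> ?X\<close> by (auto simp: BijGroup_def compose_def)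
  qed
  have step: "f a \<in> ?X \<Longrightarrow> \<exists>g\<in>?gen. g a = U_op m n (f a) b"
    if "f \<in> ?gen" "a \<in> ?X" "b \<in> ?X" for f a b
  proof -
    assume "f a \<in> ?X"
    have "f \<in> Bij ?X" "?t b \<in> Bij ?X"
      using that B.generate_in_carrier[of "?t ` ?X" f] t by (auto simp: BijGroup_def)
    then have "(?t b \<otimes>\<^bsub>?B\<^esub> f) a = U_op m n (f a) b"
      using that \<open>f a \<in> ?X\<close> by (simp add: BijGroup_def compose_def right_translation_def)
    moreover have "?t b \<otimes>\<^bsub>?B\<^esub> f \<in> ?gen" using that by (auto intro: generate.eng generate.incl)
    ultimately show ?thesis by blast
  qed
  have one: "\<exists>g\<in>?gen. g a = a" if "a \<in> ?X" for a
    using that by (intro bexI[of _ "\<one>\<^bsub>?B\<^esub>"] generate.one) (simp add: BijGroup_def)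
  have reach1: "\<exists>g\<in>?gen. g (Inl i) = Inl ((i + k) mod m)" if "i < m" for i k
  proof (induction k)
    case 0
    then show ?case using one[of "Inl i"] that by (simp add: U_set_def U_orbit1_def)
  next
    case (Suc k)
    then obtain f where f: "f \<in> ?gen" "f (Inl i) = Inl ((i + k) mod m)" by blast
    have "f (Inl i) \<in> ?X" "Inl i \<in> ?X" "Inr 0 \<in> ?X"
      using f that assms by (auto simp: U_set_def U_orbit1_def U_orbit2_def)
    from step[OF f(1) this(2,3,1)] show ?case using f by (simp add: mod_Suc_eq)
  qed
  have reach2: "\<exists>g\<in>?gen. g (Inr i) = Inr ((i + k) mod n)" if "i < n" for i k
  proof (induction k)
    case 0
    then show ?case using one[of "Inr i"] that by (simp add: U_set_def U_orbit2_def)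
  next
    case (Suc k)
    then obtain f where f: "f \<in> ?gen" "f (Inr i) = Inr ((i + k) mod n)" by blast
    have "f (Inr i) \<in> ?X" "Inr i \<in> ?X" "Inl 0 \<in> ?X"
      using f that assms by (auto simp: U_set_def U_orbit1_def U_orbit2_def)
    from step[OF f(1) this(2,3,1)] show ?case using f by (simp add: mod_Suc_eq)
  qed
  have mod: "(i + (j + (p - i))) mod p = j" if "i < p" "j < p" for i j p :: nat
    using that by simp
  show "quandle_orbit ?X (U_op m n) a = U_orbit1 m" if a: "a \<in> U_orbit1 m"
  proof
    show "quandle_orbit ?X (U_op m n) a \<subseteq> U_orbit1 m"
      using incl[OF _ a _ bij_betw_U_op(1)[OF assms]] by (auto simp: quandle_orbit_def U_set_def)
    obtain i where i: "a = Inl i" "i < m" using a by (auto simp: U_orbit1_def)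
    show "U_orbit1 m \<subseteq> quandle_orbit ?X (U_op m n) a"
    proof
      fix c assume "c \<in> U_orbit1 m"
      then obtain j where j: "c = Inl j" "j < m" by (auto simp: U_orbit1_def)
      show "c \<in> quandle_orbit ?X (U_op m n) a"
        using reach1[OF i(2), of "j + (m - i)"] mod[OF i(2) j(2)] i j
        by (auto simp: quandle_orbit_def) metis
    qed
  qed
  show "quandle_orbit ?X (U_op m n) a = U_orbit2 n" if a: "a \<in> U_orbit2 n"
  proof
    show "quandle_orbit ?X (U_op m n) a \<subseteq> U_orbit2 n"
      using incl[OF _ a _ bij_betw_U_op(2)[OF assms]] by (auto simp: quandle_orbit_def U_set_def)
    obtain i where i: "a = Inr i" "i < n" using a by (auto simp: U_orbit2_def)
    show "U_orbit2 n \<subseteq> quandle_orbit ?X (U_op m n) a"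
    proof
      fix c assume "c \<in> U_orbit2 n"
      then obtain j where j: "c = Inr j" "j < n" by (auto simp: U_orbit2_def)
      show "c \<in> quandle_orbit ?X (U_op m n) a"
        using reach2[OF i(2), of "j + (n - i)"] mod[OF i(2) j(2)] i j
        by (auto simp: quandle_orbit_def) metis
    qed
  qed
qed

end

theory Submission
  imports Defs
begin

text \<open>Write \<open>u\<^sub>i\<close>, \<open>v\<^sub>k\<close> (\<open>i, k \<in> \<int>\<close>, read modulo \<open>m\<close> and \<open>n\<close>) for the elements of the two orbits. Modulo
  boundaries, the differences \<open>(u\<^sub>i, v\<^sub>k\<^sub>+\<^sub>1) - (u\<^sub>i, v\<^sub>k)\<close> and \<open>(u\<^sub>i\<^sub>+\<^sub>1, u\<^sub>j) - (u\<^sub>i, u\<^sub>j)\<close> are all equal to one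
  element \<open>\<delta>\<close>, and \<open>(u\<^sub>i, u\<^sub>j) = (u\<^sub>0, u\<^sub>0) + (i - j) \<delta>\<close>, \<open>(u\<^sub>i, v\<^sub>k) = (u\<^sub>i, v\<^sub>0) + k \<delta>\<close>. Periodicity forces
  \<open>m \<delta> = n \<delta> = 0\<close>, and counting \<open>i - j\<close> respectively \<open>k\<close> modulo \<open>gcd m n\<close> shows that \<open>\<delta>\<close> has order exactly
  \<open>gcd m n\<close>. Hence \<open>Q\<^sub>2\<close> of the orbit is free on \<open>(u\<^sub>0, u\<^sub>0)\<close> and the \<open>(u\<^sub>i, v\<^sub>0)\<close>, plus the cyclic group of
  \<open>\<delta>\<close>; the cycles are spanned by \<open>(u\<^sub>0, u\<^sub>0)\<close>, \<open>\<Sum>\<^sub>i (u\<^sub>i, v\<^sub>0)\<close> and \<open>\<delta>\<close>. In any abelian quandle \<open>p\<^sub>a\<close> sends a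
  commutator to a combination of differences \<open>(a', b \<triangleleft> c) - (a', b)\<close>, here multiples of \<open>\<delta>\<close>, and the
  commutator of two generators from different orbits realises \<open>\<delta>\<close> up to sign.\<close>

section \<open>Additive subgroups of chains and linearity of the boundary\<close>

text \<open>Additive subgroups are described on the ambient type, so that congruences modulo
  boundaries are computed with plain \<open>+\<close> and \<open>-\<close> instead of the operations
  of a group record.\<close>

definition diff_closed :: "'a::ab_group_add set \<Rightarrow> bool" where
  "diff_closed N \<longleftrightarrow> 0 \<in> N \<and> (\<forall>x\<in>N. \<forall>y\<in>N. x - y \<in> N)"

lemma diff_closedD:
  assumes "diff_closed N"
  shows diff_closed_0: "0 \<in> N"
    and diff_closed_diff: "x \<in> N \<Longrightarrow> y \<in> N \<Longrightarrow> x - y \<in> N"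
    and diff_closed_minus: "x \<in> N \<Longrightarrow> - x \<in> N"
    and diff_closed_add: "x \<in> N \<Longrightarrow> y \<in> N \<Longrightarrow> x + y \<in> N"
proof -
  show "0 \<in> N" and d: "x \<in> N \<Longrightarrow> y \<in> N \<Longrightarrow> x - y \<in> N" for x y
    using assms by (auto simp: diff_closed_def)
  show m: "x \<in> N \<Longrightarrow> - x \<in> N" for x
    using d[of 0 x] assms by (auto simp: diff_closed_def)
  show "x \<in> N \<Longrightarrow> y \<in> N \<Longrightarrow> x + y \<in> N"
    using d[of x "- y"] m[of y] by simp
qed

lemma diff_closed_cmul:
  assumes "diff_closed N" "x \<in> N"
  shows "frag_cmul k x \<in> N"
proof (induction k rule: int_induct[of _ 0])
  case base
  then show ?case using diff_closed_0[OF assms(1)] by simp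
next
  case (step1 i)
  then show ?case using diff_closed_add[OF assms(1)] assms(2) by (simp add: frag_cmul_distrib)
next
  case (step2 i)
  then show ?case using diff_closed_diff[OF assms(1)] assms(2) by (simp add: frag_cmul_diff_distrib)
qed

lemma rack_boundary_0 [simp]: "rack_boundary qop 0 = 0"
  and rack_boundary_add: "rack_boundary qop (c + d) = rack_boundary qop c + rack_boundary qop d"
  and rack_boundary_diff: "rack_boundary qop (c - d) = rack_boundary qop c - rack_boundary qop d"
  and rack_boundary_cmul: "rack_boundary qop (frag_cmul k c) = frag_cmul k (rack_boundary qop c)"
  by (simp_all add: rack_boundary_def frag_extend_add frag_extend_diff frag_extend_cmul)

lemma keys_rack_boundary:
  "Poly_Mapping.keys (rack_boundary qop c)
    \<subseteq> (\<Union>xs\<in>Poly_Mapping.keys c. Poly_Mapping.keys (rack_boundary qop (frag_of xs)))"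
  unfolding rack_boundary_def using keys_frag_extend by (simp add: keys_frag_extend)

lemma diff_closed_boundary_image:
  "diff_closed (rack_boundary qop ` carrier (free_Abelian_group S))"
  unfolding diff_closed_def
proof safe
  show "0 \<in> rack_boundary qop ` carrier (free_Abelian_group S)"
    by (intro image_eqI[of _ _ 0]) auto
next
  fix x y assume "x \<in> carrier (free_Abelian_group S)" "y \<in> carrier (free_Abelian_group S)"
  then have "x - y \<in> carrier (free_Abelian_group S)"
    using keys_diff[of x y] by auto
  then show "rack_boundary qop x - rack_boundary qop y \<in> rack_boundary qop ` carrier (free_Abelian_group S)"
    using rack_boundary_diff[of qop x y] by (intro image_eqI) auto
qed

lemma orbit_chains_2: "orbit_chains X Y 2 = free_Abelian_group {[a, b] | a b. a \<in> Y \<and> b \<in> X}"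
  and orbit_chains_3:
    "orbit_chains X Y 3 = free_Abelian_group {[a, b, c] | a b c. a \<in> Y \<and> b \<in> X \<and> c \<in> X}"
  and rack_chains_1: "rack_chains X (Suc 0) = free_Abelian_group {[a] | a. a \<in> X}"
  and rack_chains_2: "rack_chains X 2 = free_Abelian_group {[a, b] | a b. a \<in> X \<and> b \<in> X}"
  and rack_chains_3:
    "rack_chains X 3 = free_Abelian_group {[a, b, c] | a b c. a \<in> X \<and> b \<in> X \<and> c \<in> X}"
  unfolding orbit_chains_def rack_chains_def
  by (intro arg_cong[where f = free_Abelian_group]; fastforce simp: length_Suc_conv numeral_eq_Suc)+

lemma words_simps [simp]:
  "[] \<in> words S" "l # w \<in> words S \<longleftrightarrow> fst l \<in> S \<and> w \<in> words S"
  "w @ w' \<in> words S \<longleftrightarrow> w \<in> words S \<and> w' \<in> words S"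
  by (cases l; auto simp: words_def)+

section \<open>Orbits of a quandle\<close>

context quandle
begin

abbreviation boundaries :: "'a set \<Rightarrow> ('a list \<Rightarrow>\<^sub>0 int) set" where
  "boundaries Y \<equiv> rack_boundary qop ` carrier (orbit_chains X Y 3)"

abbreviation orbit :: "'a \<Rightarrow> 'a set" where
  "orbit \<equiv> quandle_orbit X qop"

lemma qop_closed: "a \<in> X \<Longrightarrow> b \<in> X \<Longrightarrow> qop a b \<in> X"
  using bij_right_translation[of b] by (auto simp: bij_betw_def)

lemma qop_inv_closed: "a \<in> X \<Longrightarrow> b \<in> X \<Longrightarrow> qop_inv X qop a b \<in> X"
  using bij_right_translation[of b] unfolding qop_inv_def bij_betw_def
  by (metis inv_into_into)

lemma qop_qop_inv: "a \<in> X \<Longrightarrow> b \<in> X \<Longrightarrow> qop (qop_inv X qop a b) b = a"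
  using bij_right_translation[of b] unfolding qop_inv_def
  using bij_betw_inv_into_right[of "\<lambda>x. qop x b" X X a] by simp

lemma qop_inv_qop: "a \<in> X \<Longrightarrow> b \<in> X \<Longrightarrow> qop_inv X qop (qop a b) b = a"
  using bij_right_translation[of b] unfolding qop_inv_def
  using bij_betw_inv_into_left[of "\<lambda>x. qop x b" X X a] by simp

lemma qop_cancel: "a \<in> X \<Longrightarrow> a' \<in> X \<Longrightarrow> b \<in> X \<Longrightarrow> qop a b = qop a' b \<Longrightarrow> a = a'"
  by (metis qop_inv_qop)

lemma right_translation_carrier:
  "b \<in> X \<Longrightarrow> right_translation X qop b \<in> carrier (BijGroup X)"
  using bij_right_translation[of b]
  by (auto simp: BijGroup_def Bij_def right_translation_def cong: bij_betw_cong)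

lemma generate_translations_subset:
  "generate (BijGroup X) (right_translation X qop ` X) \<subseteq> carrier (BijGroup X)"
  using right_translation_carrier by (intro group.generate_incl group_BijGroup) auto

lemma BijGroup_mult_apply:
  assumes "f \<in> carrier (BijGroup X)" "g \<in> carrier (BijGroup X)" "a \<in> X"
  shows "(f \<otimes>\<^bsub>BijGroup X\<^esub> g) a = f (g a)"
  using assms by (simp add: BijGroup_def compose_def)

lemma orbit_self: "a \<in> X \<Longrightarrow> a \<in> orbit a"
  unfolding quandle_orbit_def
  by (auto intro!: exI[of _ "\<one>\<^bsub>BijGroup X\<^esub>"] generate.one) (simp add: BijGroup_def)

lemma orbit_subset: "a \<in> X \<Longrightarrow> orbit a \<subseteq> X"
  using generate_translations_subset
  by (auto simp: quandle_orbit_def BijGroup_def Bij_def bij_betw_def)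

lemma orbit_closed:
  assumes "a \<in> X" "b \<in> X" "c \<in> orbit a"
  shows "qop c b \<in> orbit a"
proof -
  obtain f where f: "f \<in> generate (BijGroup X) (right_translation X qop ` X)" "c = f a"
    using assms by (auto simp: quandle_orbit_def)
  have "f a \<in> X" using assms f orbit_subset by auto
  then have "(right_translation X qop b \<otimes>\<^bsub>BijGroup X\<^esub> f) a = qop c b"
    using f assms generate_translations_subset right_translation_carrier
    by (subst BijGroup_mult_apply) (auto simp: right_translation_def)
  moreover have "right_translation X qop b \<otimes>\<^bsub>BijGroup X\<^esub> f
      \<in> generate (BijGroup X) (right_translation X qop ` X)"
    using f assms by (intro generate.eng) (auto intro: generate.incl)
  ultimately show ?thesis unfolding quandle_orbit_def mem_Collect_eq by metis
qed

text \<open>Composing a group element with the translation by \<open>b\<close>, or with its inverse,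
  trades the base point \<open>a\<close> for \<open>qop a b\<close> and back. Hence all points along
  a path share one quotient \<open>Q2_group\<close>.\<close>

lemma orbit_qop:
  assumes "a \<in> X" "b \<in> X"
  shows "orbit (qop a b) = orbit a"
proof
  let ?B = "BijGroup X" and ?t = "right_translation X qop b"
  let ?gen = "generate ?B (right_translation X qop ` X)"
  interpret B: group ?B by (rule group_BijGroup)
  note t = right_translation_carrier[OF assms(2)]
  have gen: "f \<in> carrier ?B" if "f \<in> ?gen" for f
    using that generate_translations_subset by auto
  have ta: "?t a = qop a b" using assms by (simp add: right_translation_def)
  show "orbit (qop a b) \<subseteq> orbit a"
  proof
    fix c assume "c \<in> orbit (qop a b)"
    then obtain f where f: "f \<in> ?gen" "c = f (qop a b)" by (auto simp: quandle_orbit_def)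
    have "(f \<otimes>\<^bsub>?B\<^esub> ?t) a = c"
      using f assms t gen ta by (simp add: BijGroup_mult_apply)
    moreover have "f \<otimes>\<^bsub>?B\<^esub> ?t \<in> ?gen"
      using f assms by (auto intro: generate.eng generate.incl)
    ultimately show "c \<in> orbit a" by (auto simp: quandle_orbit_def)
  qed
  show "orbit a \<subseteq> orbit (qop a b)"
  proof
    fix c assume "c \<in> orbit a"
    then obtain f where f: "f \<in> ?gen" "c = f a" by (auto simp: quandle_orbit_def)
    let ?h = "f \<otimes>\<^bsub>?B\<^esub> inv\<^bsub>?B\<^esub> ?t"
    have h: "?h \<in> ?gen"
      using f assms by (auto intro: generate.eng generate.inv)
    have "?h \<otimes>\<^bsub>?B\<^esub> ?t = f" using f gen t by (simp add: B.m_assoc)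
    then have "?h (qop a b) = c"
      using f assms t gen[OF h] ta by (metis BijGroup_mult_apply)
    then show "c \<in> orbit (qop a b)" using h by (auto simp: quandle_orbit_def)
  qed
qed

lemma orbit_qop_inv: "a \<in> X \<Longrightarrow> b \<in> X \<Longrightarrow> orbit (qop_inv X qop a b) = orbit a"
  by (metis orbit_qop qop_inv_closed qop_qop_inv)

subsection \<open>Words acting on a quandle and the chains they trace\<close>

fun letter_act :: "'a \<Rightarrow> 'a \<times> bool \<Rightarrow> 'a" where
  "letter_act a (b, e) = (if e then qop a b else qop_inv X qop a b)"

fun letter_path :: "'a \<Rightarrow> 'a \<times> bool \<Rightarrow> 'a list \<Rightarrow>\<^sub>0 int" where
  "letter_path a (b, e) = (if e then frag_of [a, b] else - frag_of [qop_inv X qop a b, b])"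

fun word_act :: "'a \<Rightarrow> 'a word \<Rightarrow> 'a" where
  "word_act a [] = a"
| "word_act a (l # w) = word_act (letter_act a l) w"

text \<open>Chain-level lift of the path map: the rule for \<open>p_a\<close> on products, run
  letter by letter from the moving base point, before passing to the quotient.\<close>

fun word_path :: "'a \<Rightarrow> 'a word \<Rightarrow> 'a list \<Rightarrow>\<^sub>0 int" where
  "word_path a [] = 0"
| "word_path a (l # w) = letter_path a l + word_path (letter_act a l) w"

lemma letter_act_closed: "a \<in> X \<Longrightarrow> fst l \<in> X \<Longrightarrow> letter_act a l \<in> X"
  by (cases l) (simp add: qop_closed qop_inv_closed)

lemma letter_act_orbit: "a \<in> X \<Longrightarrow> fst l \<in> X \<Longrightarrow> orbit (letter_act a l) = orbit a"
  by (cases l) (simp add: orbit_qop orbit_qop_inv)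

lemma word_act_closed: "a \<in> X \<Longrightarrow> w \<in> words X \<Longrightarrow> word_act a w \<in> X"
  by (induction w arbitrary: a) (simp_all add: letter_act_closed)

lemma word_act_orbit: "a \<in> X \<Longrightarrow> w \<in> words X \<Longrightarrow> orbit (word_act a w) = orbit a"
  by (induction w arbitrary: a) (simp_all add: letter_act_closed letter_act_orbit)

lemma word_act_append: "word_act a (w @ w') = word_act (word_act a w) w'"
  by (induction w arbitrary: a) simp_all

lemma word_path_append: "word_path a (w @ w') = word_path a w + word_path (word_act a w) w'"
  by (induction w arbitrary: a) (simp_all add: add.assoc)

text \<open>The inverse letter contributes the negative chain at the displaced point, so the pair
  cancels exactly and not merely modulo boundaries.\<close>

lemma word_path_cancel:
  assumes "a \<in> X" "b \<in> X"
  shows "word_path a [(b, e), (b, \<not> e)] = 0" "word_act a [(b, e), (b, \<not> e)] = a"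
  using assms by (auto simp: qop_qop_inv qop_inv_qop)

lemma diff_closed_boundaries: "diff_closed (boundaries Y)"
  unfolding orbit_chains_3 by (rule diff_closed_boundary_image)

text \<open>Well-definedness on the structure group. Replacing \<open>g_b g_c\<close> by
  \<open>g_c g_(qop b c)\<close> changes the path from \<open>a\<close> by exactly the boundary of
  \<open>[a, b, c]\<close>, and self-distributivity keeps the endpoint. The other rules use that
  boundaries form a subgroup depending only on the orbit.\<close>

lemma word_pres_eq:
  assumes "pres_eq X (structure_rels X qop) w w'" "a \<in> X"
  shows "word_act a w = word_act a w' \<and> word_path a w - word_path a w' \<in> boundaries (orbit a)"
  using assms
proof (induction arbitrary: a rule: pres_eq.induct)
  case (refl w)
  show ?case using diff_closed_0[OF diff_closed_boundaries] by simp
next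
  case (sym w w')
  then show ?case using diff_closed_minus[OF diff_closed_boundaries] by (metis minus_diff_eq)
next
  case (trans u v w)
  have "word_path a u - word_path a w = (word_path a u - word_path a v) + (word_path a v - word_path a w)"
    by simp
  then show ?case using trans diff_closed_add[OF diff_closed_boundaries] by metis
next
  case (append u u' v v')
  have u: "word_act a u = word_act a u'" "word_path a u - word_path a u' \<in> boundaries (orbit a)"
    using append by auto
  have "u \<in> words X" using append.hyps(1) pres_eq_words by blast
  then have a': "word_act a u \<in> X" "orbit (word_act a u) = orbit a"
    using append.prems word_act_closed word_act_orbit by auto
  have v: "word_act (word_act a u) v = word_act (word_act a u) v'"
    "word_path (word_act a u) v - word_path (word_act a u) v' \<in> boundaries (orbit a)"
    using append.IH(2)[OF a'(1)] a'(2) by auto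
  have "word_path a (u @ v) - word_path a (u' @ v') =
     (word_path a u - word_path a u') + (word_path (word_act a u) v - word_path (word_act a u) v')"
    using u(1) by (simp add: word_path_append)
  then show ?case using u v diff_closed_add[OF diff_closed_boundaries] by (simp add: word_act_append)
next
  case (cancel s e)
  then show ?case using word_path_cancel[of a s e] diff_closed_0[OF diff_closed_boundaries] by simp
next
  case (rel u v)
  then obtain b c where bc: "u = [(b, True), (c, True)]" "v = [(c, True), (qop b c, True)]"
    "b \<in> X" "c \<in> X"
    by (auto simp: structure_rels_def)
  have "word_path a u - word_path a v = rack_boundary qop (frag_of [a, b, c])"
    using bc by (simp add: rack_boundary_3)
  moreover have "frag_of [a, b, c] \<in> carrier (orbit_chains X (orbit a) 3)"
    using rel.prems bc orbit_self by (auto simp: orbit_chains_3)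
  ultimately show ?case using bc rel.prems self_distrib by auto
qed

section \<open>The structure group in terms of words, and its action\<close>

lemma structure_group_simps:
  "carrier (structure_group X qop) = pres_class X (structure_rels X qop) ` words X"
  "\<one>\<^bsub>structure_group X qop\<^esub> = pres_class X (structure_rels X qop) []"
  by (simp_all add: structure_group_def presented_group_def)

abbreviation sclass :: "'a word \<Rightarrow> 'a word set" where
  "sclass \<equiv> pres_class X (structure_rels X qop)"

lemma sclass_mult:
  "w \<in> words X \<Longrightarrow> w' \<in> words X \<Longrightarrow> sclass w \<otimes>\<^bsub>structure_group X qop\<^esub> sclass w' = sclass (w @ w')"
  by (simp add: structure_group_def mult_pres_class)

lemma sclass_closed: "w \<in> words X \<Longrightarrow> sclass w \<in> carrier (structure_group X qop)"
  by (simp add: structure_group_simps)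

lemma group_structure_group: "group (structure_group X qop)"
  by (simp add: structure_group_def group_presented_group)

definition inv_word :: "'a word \<Rightarrow> 'a word" where
  "inv_word w = map (\<lambda>(s, e). (s, \<not> e)) (rev w)"

lemma inv_word_words: "w \<in> words X \<Longrightarrow> inv_word w \<in> words X"
  by (auto simp: words_def inv_word_def)

lemma inv_word_inv_word: "inv_word (inv_word w) = w"
  by (simp add: inv_word_def rev_map o_def case_prod_beta')

lemma sclass_inv:
  assumes "w \<in> words X"
  shows "inv\<^bsub>structure_group X qop\<^esub> (sclass w) = sclass (inv_word w)"
proof (rule group.inv_equality[OF group_structure_group])
  show "sclass (inv_word w) \<otimes>\<^bsub>structure_group X qop\<^esub> sclass w = \<one>\<^bsub>structure_group X qop\<^esub>"
    using assms pres_eq_inverse[OF assms] inv_word_words[OF assms]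
    by (simp add: sclass_mult structure_group_simps pres_class_eq_iff inv_word_def)
qed (use assms in \<open>auto intro: sclass_closed inv_word_words\<close>)

text \<open>Letter pairs cancel from the inside out, each exactly on chains, so no boundary term
  appears.\<close>

lemma word_inv:
  assumes "a \<in> X" "w \<in> words X"
  shows "word_act a (inv_word w @ w) = a" "word_path a (inv_word w @ w) = 0"
proof -
  have "word_act a (inv_word w @ w) = a \<and> word_path a (inv_word w @ w) = 0"
    using assms
  proof (induction w arbitrary: a)
    case Nil
    then show ?case by (simp add: inv_word_def)
  next
    case (Cons l w)
    obtain b e where l: "l = (b, e)" by force
    let ?c = "word_act a (inv_word w)"
    have c: "?c \<in> X" "b \<in> X" using Cons.prems l by (auto intro: word_act_closed inv_word_words)
    have eq: "inv_word (l # w) @ l # w = inv_word w @ [(b, \<not> e), (b, \<not> \<not> e)] @ w"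
      by (simp add: inv_word_def l)
    show ?case
      using Cons.IH[of a] Cons.prems unfolding eq word_act_append word_path_append
        word_path_cancel[OF c]
      by simp
  qed
  then show "word_act a (inv_word w @ w) = a" "word_path a (inv_word w @ w) = 0" by auto
qed

lemma sclass_self: "w \<in> words X \<Longrightarrow> w \<in> sclass w"
  by (simp add: pres_class_def pres_eq.refl)

text \<open>A chosen representative, through which functions of words become functions on the
  structure group.\<close>

definition class_word :: "'a word set \<Rightarrow> 'a word" where
  "class_word g = (SOME w. w \<in> g)"

lemma class_word_sclass:
  assumes "w \<in> words X"
  shows "pres_eq X (structure_rels X qop) w (class_word (sclass w))"
proof -
  have "class_word (sclass w) \<in> sclass w"
    unfolding class_word_def using sclass_self[OF assms] by (rule someI)
  then show ?thesis by (simp add: pres_class_def)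
qed

lemma word_act_class_word: "w \<in> words X \<Longrightarrow> a \<in> X \<Longrightarrow> word_act a (class_word (sclass w)) = word_act a w"
  using word_pres_eq[OF class_word_sclass] by metis

lemma carrier_structure_groupE:
  assumes "g \<in> carrier (structure_group X qop)"
  obtains w where "w \<in> words X" "g = sclass w"
  using assms by (auto simp: structure_group_simps)

text \<open>Resolves the definite description. Acting through representatives meets the
  specification, and any other solution agrees with it on every word, by induction on the
  letters.\<close>

lemma structure_action_sclass:
  assumes "a \<in> X" "w \<in> words X"
  shows "structure_action X qop a (sclass w) = word_act a w"
proof -
  let ?G = "structure_group X qop"
  let ?P = "\<lambda>act. act \<in> X \<rightarrow>\<^sub>E carrier ?G \<rightarrow>\<^sub>E X
       \<and> (\<forall>a\<in>X. act a \<one>\<^bsub>?G\<^esub> = a)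
       \<and> (\<forall>a\<in>X. \<forall>g\<in>carrier ?G. \<forall>h\<in>carrier ?G. act a (g \<otimes>\<^bsub>?G\<^esub> h) = act (act a g) h)
       \<and> (\<forall>a\<in>X. \<forall>b\<in>X. act a (structure_gen X qop b) = qop a b)"
  define A where "A = (\<lambda>a\<in>X. \<lambda>g\<in>carrier ?G. word_act a (class_word g))"
  have A: "A a (sclass w) = word_act a w" if "a \<in> X" "w \<in> words X" for a w
    using that by (simp add: A_def sclass_closed word_act_class_word)
  have PA: "?P A"
  proof (intro conjI ballI)
    have "A a g \<in> X" if "a \<in> X" "g \<in> carrier ?G" for a g
      using that by (elim carrier_structure_groupE) (simp add: A word_act_closed)
    then show "A \<in> X \<rightarrow>\<^sub>E carrier ?G \<rightarrow>\<^sub>E X"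
      by (auto simp: A_def)
  next
    fix a g h assume "a \<in> X" "g \<in> carrier ?G" "h \<in> carrier ?G"
    then show "A a (g \<otimes>\<^bsub>?G\<^esub> h) = A (A a g) h"
      by (elim carrier_structure_groupE) (simp add: A sclass_mult word_act_append word_act_closed)
  qed (simp_all add: A structure_group_simps structure_gen_def)
  have P: "act a (sclass w) = word_act a w" if "?P act" "a \<in> X" "w \<in> words X" for act a w
    using that(2,3)
  proof (induction w arbitrary: a)
    case Nil
    then show ?case using that(1) by (simp flip: structure_group_simps)
  next
    case (Cons l w)
    obtain b e where l: "l = (b, e)" by force
    have bX: "b \<in> X" using Cons.prems l by simp
    have hom: "\<And>a u v. a \<in> X \<Longrightarrow> u \<in> words X \<Longrightarrow> v \<in> words X
        \<Longrightarrow> act a (sclass (u @ v)) = act (act a (sclass u)) (sclass v)"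
      using that(1) by (simp add: sclass_closed flip: sclass_mult)
    have gen: "\<And>a. a \<in> X \<Longrightarrow> act a (sclass [(b, True)]) = qop a b"
      using that(1) bX by (simp add: structure_gen_def)
    have closed: "\<And>a g. a \<in> X \<Longrightarrow> g \<in> carrier ?G \<Longrightarrow> act a g \<in> X"
      using that(1) by (meson PiE_mem)
    have "act a (sclass [l]) = letter_act a l"
    proof (cases e)
      case True
      then show ?thesis using gen[OF Cons.prems(1)] l by simp
    next
      case False
      let ?c = "act a (sclass [l])"
      have cX: "?c \<in> X" using Cons.prems by (intro closed sclass_closed) simp_all
      \<comment> \<open>The specification prescribes only the generators. An inverse letter is
        forced: following it by the generator gives the identity, so its value is the preimage of
        \<open>a\<close> under the translation by \<open>b\<close>.\<close>
      have "qop ?c b = act a (sclass ([l] @ [(b, True)]))"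
        using hom[of a "[l]" "[(b, True)]"] gen[OF cX] Cons.prems bX by simp
      also have "sclass ([l] @ [(b, True)]) = sclass []"
        using pres_eq.cancel[OF bX, of "structure_rels X qop" False] l False bX
        by (simp add: pres_class_eq_iff)
      also have "act a (sclass []) = a"
        using that(1) Cons.prems by (simp flip: structure_group_simps)
      finally show ?thesis
        using l False cX bX qop_inv_qop by fastforce
    qed
    then show ?case
      using hom[of a "[l]" w] Cons by (simp add: letter_act_closed)
  qed
  have "(THE act. ?P act) = A"
  proof (rule the_equality[where P = ?P, OF PA])
    fix act assume act: "?P act"
    show "act = A"
    proof (rule PiE_ext[of _ X "\<lambda>_. carrier ?G \<rightarrow>\<^sub>E X"])
      show "act \<in> X \<rightarrow>\<^sub>E carrier ?G \<rightarrow>\<^sub>E X" "A \<in> X \<rightarrow>\<^sub>E carrier ?G \<rightarrow>\<^sub>E X"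
        using act PA by blast+
      fix a assume a: "a \<in> X"
      show "act a = A a"
      proof (rule PiE_ext[of _ "carrier ?G" "\<lambda>_. X"])
        show "act a \<in> carrier ?G \<rightarrow>\<^sub>E X" "A a \<in> carrier ?G \<rightarrow>\<^sub>E X"
          using act PA a by (meson PiE_mem)+
        fix g assume "g \<in> carrier ?G"
        then show "act a g = A a g"
          using P[OF act a] A[OF a] by (elim carrier_structure_groupE) simp
      qed
    qed
  qed
  then have "structure_action X qop = A"
    by (simp add: structure_action_def Let_def)
  then show ?thesis using A assms by simp
qed

end

subsection \<open>Path maps\<close>

context quandle
begin

section \<open>The quotients \<open>Q2_group\<close>, and path maps into them\<close>

lemma boundaries_subset:
  assumes "Y \<subseteq> X" "\<And>a b. a \<in> Y \<Longrightarrow> b \<in> X \<Longrightarrow> qop a b \<in> Y"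
  shows "boundaries Y \<subseteq> carrier (orbit_chains X Y 2)"
proof -
  have "Poly_Mapping.keys (rack_boundary qop (frag_of [a, b, c])) \<subseteq> {[a, b] | a b. a \<in> Y \<and> b \<in> X}"
    if "a \<in> Y" "b \<in> X" "c \<in> X" for a b c
  proof -
    have "Poly_Mapping.keys (rack_boundary qop (frag_of [a, b, c]))
        \<subseteq> {[qop a b, c], [a, c], [qop a c, qop b c], [a, b]}"
      unfolding rack_boundary_3
      by (intro order_trans[OF keys_add] order_trans[OF keys_diff] Un_least) (auto simp: keys_frag_of)
    then show ?thesis using that assms qop_closed by blast
  qed
  then have "Poly_Mapping.keys (rack_boundary qop c) \<subseteq> {[a, b] | a b. a \<in> Y \<and> b \<in> X}"
    if "Poly_Mapping.keys c \<subseteq> {[a, b, c] | a b c. a \<in> Y \<and> b \<in> X \<and> c \<in> X}" for c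
    using that by (intro order_trans[OF keys_rack_boundary]) blast
  then show ?thesis unfolding orbit_chains_2 orbit_chains_3 by auto
qed

lemma orbit_boundaries_subset: "a \<in> X \<Longrightarrow> boundaries (orbit a) \<subseteq> carrier (orbit_chains X (orbit a) 2)"
  using boundaries_subset[OF orbit_subset orbit_closed] by blast

lemma boundaries_normal:
  assumes "boundaries Y \<subseteq> carrier (orbit_chains X Y 2)"
  shows "boundaries Y \<lhd> orbit_chains X Y 2"
proof -
  interpret C: comm_group "orbit_chains X Y 2"
    by (simp add: orbit_chains_def abelian_free_Abelian_group)
  note B = diff_closed_boundaries[of Y]
  have "subgroup (boundaries Y) (orbit_chains X Y 2)"
  proof (rule C.subgroupI[OF assms])
    show "boundaries Y \<noteq> {}" using diff_closed_0[OF B] by blast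
    show "inv\<^bsub>orbit_chains X Y 2\<^esub> x \<in> boundaries Y" if "x \<in> boundaries Y" for x
      using that assms diff_closed_minus[OF B that] by (auto simp: orbit_chains_def)
    show "x \<otimes>\<^bsub>orbit_chains X Y 2\<^esub> y \<in> boundaries Y" if "x \<in> boundaries Y" "y \<in> boundaries Y" for x y
      using diff_closed_add[OF B that] by (simp add: orbit_chains_def)
  qed
  then show ?thesis by (simp add: C.normal_iff_subgroup)
qed

lemma group_Q2:
  assumes "boundaries Y \<subseteq> carrier (orbit_chains X Y 2)"
  shows "group (Q2_group X qop Y)"
  unfolding Q2_group_def using normal.factorgroup_is_group[OF boundaries_normal[OF assms]] .

lemma carrier_Q2: "carrier (Q2_group X qop Y) = Q2_class X qop Y ` carrier (orbit_chains X Y 2)"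
  by (simp add: Q2_group_def Q2_class_def carrier_FactGroup)

lemma Q2_class_mult:
  assumes "boundaries Y \<subseteq> carrier (orbit_chains X Y 2)"
    "c \<in> carrier (orbit_chains X Y 2)" "d \<in> carrier (orbit_chains X Y 2)"
  shows "Q2_class X qop Y c \<otimes>\<^bsub>Q2_group X qop Y\<^esub> Q2_class X qop Y d = Q2_class X qop Y (c + d)"
  using normal.rcos_sum[OF boundaries_normal[OF assms(1)] assms(2,3)]
  by (simp add: Q2_group_def Q2_class_def) (simp add: orbit_chains_def)

text \<open>Passes from equality of cosets to a congruence of chains, where the remaining
  computations take place.\<close>

lemma Q2_class_eq_iff:
  assumes "boundaries Y \<subseteq> carrier (orbit_chains X Y 2)"
    "c \<in> carrier (orbit_chains X Y 2)" "d \<in> carrier (orbit_chains X Y 2)"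
  shows "Q2_class X qop Y c = Q2_class X qop Y d \<longleftrightarrow> c - d \<in> boundaries Y"
proof -
  have 1: "Q2_class X qop Y e = (\<lambda>b. b + e) ` boundaries Y" for e
    unfolding Q2_class_def r_coset_def by (auto simp: orbit_chains_def)
  note B = diff_closed_boundaries[of Y]
  show ?thesis
  proof
    assume "Q2_class X qop Y c = Q2_class X qop Y d"
    moreover have "c \<in> Q2_class X qop Y c" unfolding 1 using diff_closed_0[OF B] by force
    ultimately show "c - d \<in> boundaries Y" unfolding 1 by auto
  next
    assume cd: "c - d \<in> boundaries Y"
    have "b + c \<in> (\<lambda>b. b + d) ` boundaries Y" if "b \<in> boundaries Y" for b
      by (intro image_eqI[of _ _ "b + (c - d)"] diff_closed_add[OF B that cd]) simp
    moreover have "b + d \<in> (\<lambda>b. b + c) ` boundaries Y" if "b \<in> boundaries Y" for b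
      by (intro image_eqI[of _ _ "b - (c - d)"] diff_closed_diff[OF B that cd]) simp
    ultimately show "Q2_class X qop Y c = Q2_class X qop Y d" unfolding 1 by blast
  qed
qed

lemma Q2_class_one: "Q2_class X qop Y 0 = \<one>\<^bsub>Q2_group X qop Y\<^esub>"
  unfolding Q2_class_def Q2_group_def r_coset_def by (auto simp: orbit_chains_def)

lemma Q2_class_inv:
  assumes "boundaries Y \<subseteq> carrier (orbit_chains X Y 2)" "c \<in> carrier (orbit_chains X Y 2)"
  shows "inv\<^bsub>Q2_group X qop Y\<^esub> Q2_class X qop Y c = Q2_class X qop Y (- c)"
proof (rule group.inv_equality[OF group_Q2[OF assms(1)]])
  have m: "- c \<in> carrier (orbit_chains X Y 2)" using assms(2) by (simp add: orbit_chains_def)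
  then show "Q2_class X qop Y (- c) \<otimes>\<^bsub>Q2_group X qop Y\<^esub> Q2_class X qop Y c = \<one>\<^bsub>Q2_group X qop Y\<^esub>"
    using assms by (simp add: Q2_class_mult Q2_class_one)
  show "Q2_class X qop Y c \<in> carrier (Q2_group X qop Y)"
    "Q2_class X qop Y (- c) \<in> carrier (Q2_group X qop Y)"
    using m assms(2) by (auto simp: carrier_Q2)
qed

lemma Q2_class_int_pow:
  assumes "boundaries Y \<subseteq> carrier (orbit_chains X Y 2)" "c \<in> carrier (orbit_chains X Y 2)"
  shows "Q2_class X qop Y c [^]\<^bsub>Q2_group X qop Y\<^esub> (k::int) = Q2_class X qop Y (frag_cmul k c)"
  using normal.FactGroup_int_pow[OF boundaries_normal[OF assms(1)] assms(2), of k] assms(2)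
  by (simp add: Q2_group_def Q2_class_def orbit_chains_def)

lemma letter_path_carrier:
  assumes "a \<in> X" "fst l \<in> X"
  shows "letter_path a l \<in> carrier (orbit_chains X (orbit a) 2)"
proof -
  obtain b e where l: "l = (b, e)" by force
  have "qop_inv X qop a b \<in> orbit a"
    using assms l orbit_self[OF qop_inv_closed] orbit_qop_inv by fastforce
  then show ?thesis using assms l orbit_self by (auto simp: orbit_chains_2)
qed

lemma word_path_carrier:
  assumes "a \<in> X" "w \<in> words X"
  shows "word_path a w \<in> carrier (orbit_chains X (orbit a) 2)"
  using assms
proof (induction w arbitrary: a)
  case Nil
  then show ?case by (simp add: orbit_chains_def)
next
  case (Cons l w)
  have "letter_path a l \<in> carrier (orbit_chains X (orbit a) 2)"
    "word_path (letter_act a l) w \<in> carrier (orbit_chains X (orbit a) 2)"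
    using Cons.IH[of "letter_act a l"] Cons.prems letter_path_carrier[of a l]
      letter_act_orbit[of a l]
    by (simp_all add: letter_act_closed)
  then show ?case by (auto simp: orbit_chains_def dest!: subsetD[OF keys_add])
qed

text \<open>Resolves the definite description of the path maps. Existence takes
  \<open>word_path\<close> on representatives, independent of the choice by
  \<open>word_pres_eq\<close>; uniqueness is an induction on words, since the values on letters and
  the product rule determine everything.\<close>

lemma path_map_sclass:
  assumes "a \<in> X" "w \<in> words X"
  shows "path_map X qop a (sclass w) = Q2_class X qop (orbit a) (word_path a w)"
proof -
  let ?G = "structure_group X qop"
  let ?Q = "\<lambda>a. Q2_group X qop (orbit a)"
  let ?cls = "\<lambda>a b. Q2_class X qop (orbit a) (frag_of [a, b])"
  let ?P = "\<lambda>p. p \<in> (\<Pi>\<^sub>E a\<in>X. carrier ?G \<rightarrow>\<^sub>E carrier (?Q a))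
       \<and> (\<forall>a\<in>X. \<forall>b\<in>X. p a (structure_gen X qop b) = ?cls a b)
       \<and> (\<forall>a\<in>X. \<forall>b\<in>X. p a (inv\<^bsub>?G\<^esub> structure_gen X qop b) = inv\<^bsub>?Q a\<^esub> ?cls (qop_inv X qop a b) b)
       \<and> (\<forall>a\<in>X. \<forall>g\<in>carrier ?G. \<forall>h\<in>carrier ?G.
            p a (g \<otimes>\<^bsub>?G\<^esub> h) = p a g \<otimes>\<^bsub>?Q a\<^esub> p (structure_action X qop a g) h)"
  note sub = orbit_boundaries_subset
  define A where "A = (\<lambda>a\<in>X. \<lambda>g\<in>carrier ?G. Q2_class X qop (orbit a) (word_path a (class_word g)))"
  have A: "A a (sclass w) = Q2_class X qop (orbit a) (word_path a w)" if "a \<in> X" "w \<in> words X" for a w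
  proof -
    note cw = class_word_sclass[OF that(2)]
    have "class_word (sclass w) \<in> words X" using cw pres_eq_words by blast
    then have "Q2_class X qop (orbit a) (word_path a w)
        = Q2_class X qop (orbit a) (word_path a (class_word (sclass w)))"
      using word_pres_eq[OF cw that(1)] that
      by (subst Q2_class_eq_iff[OF sub]) (simp_all add: word_path_carrier)
    then show ?thesis using that by (simp add: A_def sclass_closed)
  qed
  have inv_gen: "inv\<^bsub>?G\<^esub> structure_gen X qop b = sclass [(b, False)]" if "b \<in> X" for b
    using sclass_inv[of "[(b, True)]"] that by (simp add: structure_gen_def inv_word_def)
  \<comment> \<open>The prescribed value is formed at the base point
    \<open>qop_inv X qop a b\<close>; its orbit is that of \<open>a\<close>, so both sides lie in
    the same quotient.\<close>
  have letter: "Q2_class X qop (orbit a) (word_path a [(b, False)])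
      = inv\<^bsub>?Q a\<^esub> ?cls (qop_inv X qop a b) b" if "a \<in> X" "b \<in> X" for a b
  proof -
    have "frag_of [qop_inv X qop a b, b] \<in> carrier (orbit_chains X (orbit a) 2)"
      using that orbit_self[OF qop_inv_closed[OF that]] orbit_qop_inv[OF that]
      by (auto simp: orbit_chains_2)
    from Q2_class_inv[OF sub this] that show ?thesis by (simp add: orbit_qop_inv)
  qed
  have PA: "?P A"
  proof (intro conjI ballI)
    have "A a g \<in> carrier (?Q a)" if "a \<in> X" "g \<in> carrier ?G" for a g
      using that by (elim carrier_structure_groupE) (auto simp: A carrier_Q2 intro: word_path_carrier)
    then show "A \<in> (\<Pi>\<^sub>E a\<in>X. carrier ?G \<rightarrow>\<^sub>E carrier (?Q a))"
      by (auto simp: A_def)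
  next
    fix a b assume "a \<in> X" "b \<in> X"
    then show "A a (structure_gen X qop b) = ?cls a b"
      by (simp add: A structure_gen_def)
  next
    fix a b assume ab: "a \<in> X" "b \<in> X"
    then show "A a (inv\<^bsub>?G\<^esub> structure_gen X qop b) = inv\<^bsub>?Q a\<^esub> ?cls (qop_inv X qop a b) b"
      using A[of a "[(b, False)]"] letter[OF ab] inv_gen by simp
  next
    fix a g h assume a: "a \<in> X" and "g \<in> carrier ?G" "h \<in> carrier ?G"
    then obtain u v where uv: "u \<in> words X" "g = sclass u" "v \<in> words X" "h = sclass v"
      by (metis carrier_structure_groupE)
    have "word_path (word_act a u) v \<in> carrier (orbit_chains X (orbit a) 2)"
      using a uv word_path_carrier[of "word_act a u" v] by (simp add: word_act_closed word_act_orbit)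
    then show "A a (g \<otimes>\<^bsub>?G\<^esub> h) = A a g \<otimes>\<^bsub>?Q a\<^esub> A (structure_action X qop a g) h"
      using a uv sub[OF a] word_path_carrier[of a u]
      by (simp add: A sclass_mult structure_action_sclass word_act_closed word_act_orbit
          word_path_append Q2_class_mult)
  qed
  have P: "p a (sclass w) = Q2_class X qop (orbit a) (word_path a w)"
    if "?P p" "a \<in> X" "w \<in> words X" for p a w
  proof -
    have hom: "\<And>a u v. a \<in> X \<Longrightarrow> u \<in> words X \<Longrightarrow> v \<in> words X
        \<Longrightarrow> p a (sclass (u @ v)) = p a (sclass u) \<otimes>\<^bsub>?Q a\<^esub> p (word_act a u) (sclass v)"
      using that(1) by (simp add: sclass_closed structure_action_sclass flip: sclass_mult)
    have closed: "\<And>a w. a \<in> X \<Longrightarrow> w \<in> words X \<Longrightarrow> p a (sclass w) \<in> carrier (?Q a)"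
      using that(1) sclass_closed by (meson PiE_mem)
    show ?thesis using that(2,3)
    proof (induction w arbitrary: a)
      case Nil
      interpret Q: group "?Q a" by (rule group_Q2[OF sub[OF Nil(1)]])
      \<comment> \<open>The value at the identity is not prescribed, but it is idempotent in a group
        and hence equal to one.\<close>
      have "p a (sclass []) \<otimes>\<^bsub>?Q a\<^esub> p a (sclass []) = p a (sclass [])"
        using hom[of a "[]" "[]"] Nil by simp
      then show ?case using closed[of a "[]"] Nil by (simp add: Q2_class_one)
    next
      case (Cons l w)
      obtain b e where l: "l = (b, e)" by force
      have bX: "b \<in> X" using Cons.prems l by simp
      have 1: "p a (sclass [l]) = Q2_class X qop (orbit a) (word_path a [l])"
      proof (cases e)
        case True
        then show ?thesis using that(1) Cons.prems bX l by (simp add: structure_gen_def)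
      next
        case False
        then show ?thesis using that(1) Cons.prems bX l letter[of a b] inv_gen by simp
      qed
      have 2: "p (letter_act a l) (sclass w) = Q2_class X qop (orbit a) (word_path (letter_act a l) w)"
        using Cons letter_act_orbit[of a l] by (simp add: letter_act_closed)
      have "word_path (letter_act a l) w \<in> carrier (orbit_chains X (orbit a) 2)"
        using Cons.prems word_path_carrier[of "letter_act a l" w] letter_act_orbit[of a l]
        by (simp add: letter_act_closed)
      then show ?case
        using hom[of a "[l]" w] 1 2 Cons.prems sub[of a] word_path_carrier[of a "[l]"]
        by (simp add: Q2_class_mult)
    qed
  qed
  have "(THE p. ?P p) = A"
  proof (rule the_equality[where P = ?P, OF PA])
    fix p assume p: "?P p"
    show "p = A"
    proof (rule PiE_ext[of _ X "\<lambda>a. carrier ?G \<rightarrow>\<^sub>E carrier (?Q a)"])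
      show p': "p \<in> (\<Pi>\<^sub>E a\<in>X. carrier ?G \<rightarrow>\<^sub>E carrier (?Q a))"
        using p by (rule conjunct1)
      show A': "A \<in> (\<Pi>\<^sub>E a\<in>X. carrier ?G \<rightarrow>\<^sub>E carrier (?Q a))"
        using PA by (rule conjunct1)
      fix a assume a: "a \<in> X"
      show "p a = A a"
      proof (rule PiE_ext[of _ "carrier ?G" "\<lambda>_. carrier (?Q a)"])
        show "p a \<in> carrier ?G \<rightarrow>\<^sub>E carrier (?Q a)" "A a \<in> carrier ?G \<rightarrow>\<^sub>E carrier (?Q a)"
          using PiE_mem[OF p' a] PiE_mem[OF A' a] .
        fix g assume "g \<in> carrier ?G"
        then show "p a g = A a g"
          using P[OF p a] A[OF a] by (elim carrier_structure_groupE) simp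
      qed
    qed
  qed
  then have "path_map X qop = A"
    by (simp add: path_map_def Let_def)
  then show ?thesis using A assms by simp
qed

end

subsection \<open>Path maps on commutators\<close>

context abelian_quandle
begin

text \<open>In each identity the two sides agree after a right translation is applied, and right
  translations are injective.\<close>

lemma abelian_qop_inv:
  assumes "a \<in> X" "b \<in> X" "c \<in> X"
  shows "qop (qop_inv X qop a b) c = qop_inv X qop (qop a c) b"
    and "qop_inv X qop (qop_inv X qop a b) c = qop_inv X qop (qop_inv X qop a c) b"
proof -
  have 1: "qop (qop_inv X qop a b) c = qop_inv X qop (qop a c) b"
    if "a \<in> X" "b \<in> X" "c \<in> X" for a b c
    using that abelian[of "qop_inv X qop a b" c b]
    by - (rule qop_cancel[of _ _ b], simp_all add: qop_inv_closed qop_closed qop_qop_inv)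
  show "qop (qop_inv X qop a b) c = qop_inv X qop (qop a c) b" using 1 assms .
  show "qop_inv X qop (qop_inv X qop a b) c = qop_inv X qop (qop_inv X qop a c) b"
    using assms 1[of "qop_inv X qop a c" b c]
    by - (rule qop_cancel[of _ _ c], simp_all add: qop_inv_closed qop_closed qop_qop_inv)
qed

lemma letter_act_commute:
  assumes "a \<in> X" "fst l \<in> X" "fst l' \<in> X"
  shows "letter_act (letter_act a l) l' = letter_act (letter_act a l') l"
  using assms abelian abelian_qop_inv by (cases l; cases l') simp

lemma word_letter_act_commute:
  assumes "a \<in> X" "fst l \<in> X" "w \<in> words X"
  shows "word_act (letter_act a l) w = letter_act (word_act a w) l"
  using assms by (induction w arbitrary: a) (simp_all add: letter_act_closed letter_act_commute[of _ l])

lemma word_act_commute: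
  assumes "a \<in> X" "u \<in> words X" "v \<in> words X"
  shows "word_act a (u @ v) = word_act a (v @ u)"
  using assms
proof (induction u arbitrary: a)
  case (Cons l u)
  then have "word_act (letter_act a l) (u @ v) = word_act (letter_act a l) (v @ u)"
    by (simp add: letter_act_closed)
  then show ?case
    using word_letter_act_commute[of a l v] Cons.prems by (simp add: word_act_append)
qed simp

text \<open>In an abelian quandle \<open>u @ v\<close> and \<open>v @ u\<close> end at the same
  point, which makes this difference the path of the commutator of \<open>u\<close> and
  \<open>v\<close>.\<close>

definition path_comm :: "'a \<Rightarrow> 'a word \<Rightarrow> 'a word \<Rightarrow> 'a list \<Rightarrow>\<^sub>0 int" where
  "path_comm a u v = word_path a (u @ v) - word_path a (v @ u)"

text \<open>The path of \<open>v\<close> from the intermediate point \<open>word_act a u\<close> is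
  added and subtracted; since \<open>u\<close> and \<open>v\<close> commute on points, both paths of
  \<open>u'\<close> start where they should.\<close>

lemma path_comm_append:
  assumes "a \<in> X" "u \<in> words X" "u' \<in> words X" "v \<in> words X"
  shows "path_comm a (u @ u') v = path_comm a u v + path_comm (word_act a u) u' v"
  using word_act_commute[of a u v] assms
  by (simp add: path_comm_def word_path_append word_act_append algebra_simps)

lemma path_comm_swap: "path_comm a v u = - path_comm a u v"
  by (simp add: path_comm_def)

text \<open>The rack boundary of \<open>(a, b, c)\<close> turns the defect of commutativity of two generators into a
  difference \<open>(a, b \<triangleleft> c) - (a, b)\<close>; additivity of the defect reduces all words to this case.\<close>

lemma path_comm_mem:
  assumes N: "diff_closed N" "boundaries Y \<subseteq> N"
    and shift: "\<And>a b c. a \<in> X \<Longrightarrow> orbit a = Y \<Longrightarrow> b \<in> X \<Longrightarrow> c \<in> X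
      \<Longrightarrow> frag_of [a, qop b c] - frag_of [a, b] \<in> N"
    and a: "a \<in> X" "orbit a = Y" and uv: "u \<in> words X" "v \<in> words X"
  shows "path_comm a u v \<in> N"
proof -
  have gens: "path_comm a [(b, True)] [(c, True)] \<in> N"
    if "a \<in> X" "orbit a = Y" "b \<in> X" "c \<in> X" for a b c
  proof -
    have "path_comm a [(b, True)] [(c, True)] = rack_boundary qop (frag_of [a, b, c]) +
        (frag_of [qop a c, qop b c] - frag_of [qop a c, b])"
      by (simp add: path_comm_def rack_boundary_3)
    moreover have "rack_boundary qop (frag_of [a, b, c]) \<in> N"
      using that orbit_self N(2) by (auto simp: orbit_chains_3)
    moreover have "frag_of [qop a c, qop b c] - frag_of [qop a c, b] \<in> N"
      using that shift qop_closed orbit_qop by simp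
    ultimately show ?thesis using diff_closed_add[OF N(1)] by simp
  qed
  have signs: "path_comm a [(b, e)] v \<in> N"
    if pos: "\<And>a. a \<in> X \<Longrightarrow> orbit a = Y \<Longrightarrow> path_comm a [(b, True)] v \<in> N"
      and "v \<in> words X" "a \<in> X" "orbit a = Y" "b \<in> X" for a b e v
  proof (cases e)
    case True
    then show ?thesis using that by simp
  next
    case False
    \<comment> \<open>Starting one step back, the trivial word
      \<open>[(b, True), (b, False)]\<close> has defect zero. Additivity then expresses the defect
      of the inverse letter at \<open>a\<close> as minus that of the positive letter at
      \<open>?a\<close>.\<close>
    let ?a = "qop_inv X qop a b"
    have a': "?a \<in> X" "orbit ?a = Y" "qop ?a b = a"
      using that by (simp_all add: qop_inv_closed orbit_qop_inv qop_qop_inv)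
    have cancel: "word_path x [(b, True), (b, False)] = 0" "word_act x [(b, True), (b, False)] = x"
      if "x \<in> X" for x
      using word_path_cancel[OF that \<open>b \<in> X\<close>, of True] by simp_all
    have "path_comm ?a [(b, True), (b, False)] v = 0"
      unfolding path_comm_def word_path_append cancel[OF a'(1)]
        cancel[OF word_act_closed[OF a'(1) \<open>v \<in> words X\<close>]]
      by simp
    then have "path_comm a [(b, False)] v = - path_comm ?a [(b, True)] v"
      using path_comm_append[of ?a "[(b, True)]" "[(b, False)]" v] a' that
      by (simp add: eq_neg_iff_add_eq_0 add.commute)
    then show ?thesis using diff_closed_minus[OF N(1) pos[OF a'(1,2)]] False by simp
  qed
  \<comment> \<open>\<open>signs\<close> treats the first argument only; antisymmetry carries it
    over to the second. The same device is used with \<open>words\<close> below.\<close>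
  have letters: "path_comm a [(b, e)] [(c, f)] \<in> N"
    if "a \<in> X" "orbit a = Y" "b \<in> X" "c \<in> X" for a b c e f
  proof (rule signs)
    fix a assume "a \<in> X" "orbit a = Y"
    then have "path_comm a [(c, f)] [(b, True)] \<in> N"
      using that by - (rule signs, auto intro: gens)
    then show "path_comm a [(b, True)] [(c, f)] \<in> N"
      using diff_closed_minus[OF N(1)] by (subst path_comm_swap) simp
  qed (use that in auto)
  have words: "path_comm a u v \<in> N"
    if one: "\<And>a l. a \<in> X \<Longrightarrow> orbit a = Y \<Longrightarrow> fst l \<in> X \<Longrightarrow> path_comm a [l] v \<in> N"
      and "u \<in> words X" "v \<in> words X" "a \<in> X" "orbit a = Y" for a u v
    using that(2-)
  proof (induction u arbitrary: a)
    case Nil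
    then show ?case using diff_closed_0[OF N(1)] by (simp add: path_comm_def)
  next
    case (Cons l u)
    then have "path_comm a (l # u) v = path_comm a [l] v + path_comm (letter_act a l) u v"
      using path_comm_append[of a "[l]" u v] by simp
    moreover have "path_comm (letter_act a l) u v \<in> N"
      using Cons letter_act_orbit[of a l] by (simp add: letter_act_closed)
    ultimately show ?case using one[of a l] Cons.prems diff_closed_add[OF N(1)] by simp
  qed
  show ?thesis
  proof (rule words[OF _ uv a])
    fix a and l :: "'a \<times> bool" assume al: "a \<in> X" "orbit a = Y" "fst l \<in> X"
    have "path_comm a v [l] \<in> N"
      using al uv letters[of _ _ "fst l" _ "snd l"] by - (rule words, auto)
    then show "path_comm a [l] v \<in> N"
      using diff_closed_minus[OF N(1)] by (subst path_comm_swap) simp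
  qed
qed

text \<open>The representing word is also required to fix every point: then paths from a fixed base
  point simply add under concatenation, so membership in \<open>N\<close> passes from commutators to
  the group they generate.\<close>

lemma derived_word:
  assumes N: "diff_closed N" "boundaries Y \<subseteq> N"
    and shift: "\<And>a b c. a \<in> X \<Longrightarrow> orbit a = Y \<Longrightarrow> b \<in> X \<Longrightarrow> c \<in> X
      \<Longrightarrow> frag_of [a, qop b c] - frag_of [a, b] \<in> N"
    and g: "g \<in> derived (structure_group X qop) (carrier (structure_group X qop))"
  shows "\<exists>w\<in>words X. g = sclass w \<and> (\<forall>a\<in>X. word_act a w = a)
    \<and> (\<forall>a\<in>X. orbit a = Y \<longrightarrow> word_path a w \<in> N)"
proof -
  let ?G = "structure_group X qop"
  let ?R = "\<lambda>w. w \<in> words X \<and> (\<forall>a\<in>X. word_act a w = a)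
    \<and> (\<forall>a\<in>X. orbit a = Y \<longrightarrow> word_path a w \<in> N)"
  have comm: "\<exists>w. ?R w \<and> h = sclass w"
    if "h \<in> derived_set ?G (carrier ?G)" for h
  proof -
    obtain g1 g2 where g12: "g1 \<in> carrier ?G" "g2 \<in> carrier ?G"
      "h = g1 \<otimes>\<^bsub>?G\<^esub> g2 \<otimes>\<^bsub>?G\<^esub> inv\<^bsub>?G\<^esub> g1 \<otimes>\<^bsub>?G\<^esub> inv\<^bsub>?G\<^esub> g2"
      using \<open>h \<in> derived_set ?G (carrier ?G)\<close> by auto
    obtain u v where uv: "u \<in> words X" "g1 = sclass u" "v \<in> words X" "g2 = sclass v"
      using g12 by (metis carrier_structure_groupE)
    let ?w = "u @ v @ inv_word u @ inv_word v"
    have w: "?w \<in> words X" using uv by (simp add: inv_word_words)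
    have h: "h = sclass ?w"
      using uv g12 by (simp add: sclass_inv sclass_mult inv_word_words)
    \<comment> \<open>Appending \<open>v @ u\<close> to the commutator word removes both inverse
      words and leaves the path of \<open>u @ v\<close>. Once \<open>?w\<close> is known to fix
      \<open>a\<close>, its path is therefore \<open>path_comm a u v\<close>.\<close>
    have cancel: "word_act a (?w @ v @ u) = word_act a (u @ v) \<and>
        word_path a (?w @ v @ u) = word_path a (u @ v)" if "a \<in> X" for a
    proof -
      let ?b = "word_act (word_act (word_act a u) v) (inv_word u)"
      have b: "?b \<in> X" using that uv by (simp add: word_act_closed inv_word_words)
      have c: "word_act (word_act a u) v \<in> X" using that uv by (simp add: word_act_closed)
      show ?thesis
        using word_inv[OF b uv(3)] word_inv[OF c uv(1)]
        by (simp add: word_act_append word_path_append algebra_simps)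
    qed
    have act: "word_act a ?w = a" if "a \<in> X" for a
    proof -
      have inj: "b = c" if "b \<in> X" "c \<in> X" "w \<in> words X" "word_act b w = word_act c w" for b c w
        using word_inv(1)[OF that(1) inv_word_words[OF that(3)]]
          word_inv(1)[OF that(2) inv_word_words[OF that(3)]] that(4)
        by (simp add: word_act_append inv_word_inv_word)
      have "word_act (word_act a ?w) (v @ u) = word_act a (v @ u)"
        using cancel[OF that] word_act_commute[OF that uv(1,3)]
        by (simp only: word_act_append[symmetric] append_assoc)
      then show ?thesis
        using inj[of "word_act a ?w" a "v @ u"] that w uv(1,3) word_act_closed[OF that w] by simp
    qed
    have "word_path a ?w \<in> N" if "a \<in> X" "orbit a = Y" for a
    proof -
      have "word_path a (?w @ v @ u) = word_path a ?w + word_path a (v @ u)"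
        using word_path_append[of a ?w "v @ u"] act[OF that(1)] by simp
      then have "word_path a ?w = path_comm a u v"
        using cancel[OF that(1)] by (simp add: path_comm_def eq_diff_eq)
      then show ?thesis using path_comm_mem[OF N shift that uv(1,3)] by simp
    qed
    then show ?thesis using w h act by blast
  qed
  have inv_word: "?R (inv_word w)" if w: "?R w" for w
  proof (intro conjI ballI impI)
    show i: "inv_word w \<in> words X" using w inv_word_words by blast
    fix a assume a: "a \<in> X"
    then have "word_act a (inv_word w) \<in> X" using i word_act_closed by blast
    then show act: "word_act a (inv_word w) = a"
      using word_inv(1)[OF a, of w] w by (simp add: word_act_append)
    assume "orbit a = Y"
    then have "word_path a w \<in> N" using w a by blast
    moreover have "word_path a (inv_word w) = - word_path a w"
      using word_inv(2)[OF a, of w] w act by (simp add: word_path_append eq_neg_iff_add_eq_0)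
    ultimately show "word_path a (inv_word w) \<in> N" using diff_closed_minus[OF N(1)] by simp
  qed
  have "\<exists>w. ?R w \<and> g = sclass w"
    using g unfolding derived_def
  proof (induction rule: generate.induct)
    case one
    then show ?case using diff_closed_0[OF N(1)]
      by (intro exI[of _ "[]"]) (simp add: structure_group_simps)
  next
    case (incl h)
    then show ?case by (rule comm)
  next
    case (inv h)
    then obtain w where w: "?R w" "h = sclass w" using comm by blast
    then have "inv\<^bsub>?G\<^esub> h = sclass (inv_word w)" using sclass_inv by blast
    then show ?case using inv_word[OF w(1)] by blast
  next
    case (eng h1 h2)
    then obtain u v where uv: "?R u" "h1 = sclass u" "?R v" "h2 = sclass v" by blast
    then have "?R (u @ v)" "h1 \<otimes>\<^bsub>?G\<^esub> h2 = sclass (u @ v)"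
      using diff_closed_add[OF N(1)] by (auto simp: word_act_append word_path_append sclass_mult)
    then show ?case by blast
  qed
  then show ?thesis by blast
qed

end

section \<open>Integer functionals, progressions modulo a subgroup, and cyclic groups\<close>

definition int_extend :: "('b \<Rightarrow> int) \<Rightarrow> ('b \<Rightarrow>\<^sub>0 int) \<Rightarrow> int" where
  "int_extend f c = (\<Sum>x\<in>Poly_Mapping.keys c. Poly_Mapping.lookup c x * f x)"

text \<open>Viewing the integers as the free abelian group on one point lets linearity be inherited
  from \<open>frag_extend\<close>.\<close>

lemma int_extend_frag_extend:
  "int_extend f c = Poly_Mapping.lookup (frag_extend (\<lambda>x. frag_cmul (f x) (frag_of ())) c) ()"
  by (simp add: int_extend_def frag_extend_def lookup_sum)

lemma int_extend_simps [simp]: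
  "int_extend f 0 = 0"
  "int_extend f (frag_of x) = f x"
  "int_extend f (c + d) = int_extend f c + int_extend f d"
  "int_extend f (c - d) = int_extend f c - int_extend f d"
  "int_extend f (frag_cmul k c) = k * int_extend f c"
  by (simp_all add: int_extend_frag_extend frag_extend_add frag_extend_diff frag_extend_cmul
      lookup_add lookup_minus)

lemma int_extend_sum: "int_extend f (sum c I) = (\<Sum>i\<in>I. int_extend f (c i))"
  by (induction I rule: infinite_finite_induct) simp_all

lemma int_extend_eq_0: "(\<And>x. x \<in> Poly_Mapping.keys c \<Longrightarrow> f x = 0) \<Longrightarrow> int_extend f c = 0"
  by (simp add: int_extend_def)

lemma frag_cmul_minus_right: "frag_cmul k (- x) = - frag_cmul k x"
  by (metis frag_cmul_cmul frag_cmul_minus_one mult.commute)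

text \<open>Telescoping in both directions from \<open>0\<close>. Taking \<open>d = 0\<close> gives
  a sequence that is constant modulo \<open>N\<close>.\<close>

lemma progression_mem:
  assumes N: "diff_closed N" and step: "\<And>i. f (i + 1) - f i - d \<in> N"
  shows "f i - f 0 - frag_cmul i d \<in> N"
proof (induction i rule: int_induct[of _ 0])
  case base
  then show ?case using diff_closed_0[OF N] by simp
next
  case (step1 i)
  have eq: "f (i + 1) - f 0 - frag_cmul (i + 1) d
      = (f i - f 0 - frag_cmul i d) + (f (i + 1) - f i - d)"
    by (simp add: frag_cmul_distrib)
  show ?case unfolding eq by (rule diff_closed_add[OF N step1(2) step])
next
  case (step2 i)
  have eq: "f (i - 1) - f 0 - frag_cmul (i - 1) d
      = (f i - f 0 - frag_cmul i d) - (f (i - 1 + 1) - f (i - 1) - d)"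
    by (simp add: frag_cmul_diff_distrib)
  show ?case unfolding eq by (rule diff_closed_diff[OF N step2(2) step])
qed

text \<open>Recognises both the torsion groups and the parameter group. Two powers of
  \<open>x\<close> agree exactly when their exponents agree modulo \<open>d\<close>, so the powers
  indexed by the carrier of \<open>integer_mod_group d\<close> list the group without
  repetition.\<close>

lemma (in group) cyclic_iso_integer_mod_group:
  assumes x: "x \<in> carrier G" and gen: "carrier G = range (\<lambda>k::int. x [^] k)"
    and ord: "\<And>k::int. x [^] k = \<one> \<longleftrightarrow> int d dvd k"
  shows "G \<cong> integer_mod_group d"
proof -
  have eq_iff: "x [^] k = x [^] l \<longleftrightarrow> k mod int d = l mod int d" for k l :: int
  proof -
    have "x [^] k = x [^] l \<longleftrightarrow> x [^] (k - l) = \<one>"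
      using x inv_equality[of "x [^] k" "inv (x [^] l)"] by (auto simp: int_pow_diff r_inv)
    then show ?thesis using ord by (simp add: mod_eq_dvd_iff)
  qed
  have "(\<lambda>k::int. x [^] k) \<in> iso (integer_mod_group d) G"
  proof (intro isoI homI)
    fix k l
    have "x [^] ((k + l) mod int d) = x [^] (k + l)" by (simp add: eq_iff)
    then show "x [^] (k \<otimes>\<^bsub>integer_mod_group d\<^esub> l) = x [^] k \<otimes> x [^] l"
      using x by (simp add: int_pow_mult)
  next
    show "bij_betw (\<lambda>k::int. x [^] k) (carrier (integer_mod_group d)) (carrier G)"
    proof (intro bij_betwI')
      fix k l assume "k \<in> carrier (integer_mod_group d)" "l \<in> carrier (integer_mod_group d)"
      then show "(x [^] k = x [^] l) = (k = l)"
        by (auto simp: eq_iff carrier_integer_mod_group split: if_splits)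
    next
      fix y assume "y \<in> carrier G"
      then obtain k :: int where "y = x [^] k" using gen by auto
      then have "y = x [^] (k mod int d)" by (simp add: eq_iff)
      moreover have "k mod int d \<in> carrier (integer_mod_group d)"
        by (simp add: carrier_integer_mod_group)
      ultimately show "\<exists>k\<in>carrier (integer_mod_group d). y = x [^] k" by blast
    qed (use x in simp)
  qed (use x in simp)
  then show ?thesis
    using group.iso_sym[OF group_integer_mod_group] is_isoI by blast
qed

subsection \<open>Quandles with two orbits rotating each other\<close>

text \<open>Both orbits are indexed by all integers, so that a rotation is \<open>i + 1\<close>
  without a modulus and progressions can be used. The results concern the orbit of \<open>u\<close>;
  the other orbit is obtained by interpreting the locale with the two cycles exchanged.\<close>

locale two_cycles = abelian_quandle X qop for X :: "'a set" and qop +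
  fixes m n :: nat and u v :: "int \<Rightarrow> 'a"
  assumes X_eq: "X = range u \<union> range v"
    and u_eq_iff: "u i = u j \<longleftrightarrow> i mod int m = j mod int m"
    and v_eq_iff: "v k = v l \<longleftrightarrow> k mod int n = l mod int n"
    and u_neq_v [simp]: "u i \<noteq> v k"
    and qop_simps [simp]: "qop (u i) (u j) = u i" "qop (v k) (v l) = v k"
      "qop (u i) (v k) = u (i + 1)" "qop (v k) (u i) = v (k + 1)"
    and orbit_u: "orbit (u i) = range u"
    and m_pos: "m \<ge> 1"
begin

abbreviation B :: "('a list \<Rightarrow>\<^sub>0 int) set" where "B \<equiv> boundaries (range u)"

definition \<alpha> :: "'a list \<Rightarrow>\<^sub>0 int" where "\<alpha> = frag_of [u 0, u 0]"
definition \<delta> :: "'a list \<Rightarrow>\<^sub>0 int" where "\<delta> = frag_of [u 0, v 1] - frag_of [u 0, v 0]"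

lemma v_neq_u [simp]: "v k \<noteq> u i"
  using u_neq_v by metis

lemma notin_range [simp]: "u i \<notin> range v" "v k \<notin> range u"
  by (auto simp: image_iff)

lemma in_X [simp]: "u i \<in> X" "v k \<in> X"
  by (auto simp: X_eq)

lemma X_cases:
  assumes "a \<in> X"
  obtains i where "a = u i" | k where "a = v k"
  using assms by (auto simp: X_eq)

lemma diff_closed_B: "diff_closed B"
  by (rule diff_closed_boundaries)

lemma B_subset: "B \<subseteq> carrier (orbit_chains X (range u) 2)"
  using orbit_boundaries_subset[of "u 0"] by (simp add: orbit_u)

lemma boundary_mem:
  assumes "b \<in> X" "c \<in> X"
  shows "rack_boundary qop (frag_of [u i, b, c]) \<in> B"
  using assms by (auto simp: orbit_chains_3)

text \<open>The boundary of \<open>[u i, v k, u 0]\<close> equates the difference at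
  \<open>k\<close> with one that does not involve \<open>k\<close>; the boundary of
  \<open>[u i, v 0, v 1]\<close> makes it independent of \<open>i\<close>.\<close>

lemma uv_step: "frag_of [u i, v (k + 1)] - frag_of [u i, v k] - \<delta> \<in> B"
proof -
  let ?\<Delta> = "\<lambda>i k. frag_of [u i, v (k + 1)] - frag_of [u i, v k]"
  have "?\<Delta> i k - ?\<Delta> i 0 \<in> B"
    using diff_closed_diff[OF diff_closed_B boundary_mem[of "v 0" "u 0" i] boundary_mem[of "v k" "u 0" i]]
    by (simp add: rack_boundary_3 algebra_simps)
  moreover have "?\<Delta> i 0 - ?\<Delta> 0 0 - frag_cmul i 0 \<in> B"
    using boundary_mem[of "v 0" "v 1"]
    by (intro progression_mem[OF diff_closed_B]) (simp add: rack_boundary_3 algebra_simps)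
  ultimately have "(?\<Delta> i k - ?\<Delta> i 0) + (?\<Delta> i 0 - ?\<Delta> 0 0 - frag_cmul i 0) \<in> B"
    by (rule diff_closed_add[OF diff_closed_B])
  then show ?thesis by (simp add: \<delta>_def algebra_simps)
qed

text \<open>The boundary of \<open>[u i, v 0, u j]\<close> compares this difference with the one in
  \<open>uv_step\<close>.\<close>

lemma uu_step1: "frag_of [u (i + 1), u j] - frag_of [u i, u j] - \<delta> \<in> B"
  using diff_closed_add[OF diff_closed_B boundary_mem[of "v 0" "u j" i] uv_step[of i 0]]
  by (simp add: rack_boundary_3)

text \<open>The boundary of \<open>[u i, u j, v 0]\<close> identifies \<open>[u i, u j]\<close> with
  its diagonal shift, so raising the second index undoes raising the first.\<close>

lemma uu_step2: "frag_of [u i, u (j + 1)] - frag_of [u i, u j] + \<delta> \<in> B"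
proof -
  have "frag_of [u i, u j] - frag_of [u (i + 1), u (j + 1)] \<in> B"
    using boundary_mem[of "u j" "v 0" i] by (simp add: rack_boundary_3)
  from diff_closed_minus[OF diff_closed_B diff_closed_add[OF diff_closed_B this uu_step1[of i "j + 1"]]]
  show ?thesis by (simp add: algebra_simps)
qed

lemma uv_normal: "frag_of [u i, v k] - frag_of [u i, v 0] - frag_cmul k \<delta> \<in> B"
  using uv_step by (intro progression_mem[OF diff_closed_B])

lemma uu_normal1: "frag_of [u i, u j] - frag_of [u 0, u j] - frag_cmul i \<delta> \<in> B"
  using uu_step1 by (intro progression_mem[OF diff_closed_B, of "\<lambda>i. frag_of [u i, u j]"])

lemma uu_normal: "frag_of [u i, u j] - \<alpha> - frag_cmul (i - j) \<delta> \<in> B"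
proof -
  have "frag_of [u 0, u j] - frag_of [u 0, u 0] - frag_cmul j (- \<delta>) \<in> B"
    using uu_step2 by (intro progression_mem[OF diff_closed_B]) simp
  then have "frag_of [u 0, u j] - \<alpha> + frag_cmul j \<delta> \<in> B"
    by (simp add: \<alpha>_def frag_cmul_minus_right del: minus_frag_cmul)
  from diff_closed_add[OF diff_closed_B uu_normal1[of i j] this] show ?thesis
    by (simp add: frag_cmul_diff_distrib algebra_simps)
qed

lemma \<delta>_torsion:
  assumes "int (gcd m n) dvd k"
  shows "frag_cmul k \<delta> \<in> B"
proof -
  have "u (int m) = u 0" "v (int n) = v 0" by (simp_all add: u_eq_iff v_eq_iff)
  \<comment> \<open>After one full turn of either cycle the leading differences in the normal forms
    vanish and only minus a multiple of \<delta> is left. Bezout then combines the two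
    periods.\<close>
  then have mn: "frag_cmul (- int m) \<delta> \<in> B" "frag_cmul (- int n) \<delta> \<in> B"
    using uu_normal1[of "int m" 0] uv_normal[of 0 "int n"] by simp_all
  obtain x y where "x * int m + y * int n = int (gcd m n)"
    using bezout_int[of "int m" "int n"] by auto
  moreover obtain q where "k = int (gcd m n) * q" using assms by blast
  ultimately have "k = (x * int m + y * int n) * q" by simp
  then have "k = (- q * x) * (- int m) + (- q * y) * (- int n)"
    by (simp add: algebra_simps)
  then have "frag_cmul k \<delta> = frag_cmul (- q * x) (frag_cmul (- int m) \<delta>)
      + frag_cmul (- q * y) (frag_cmul (- int n) \<delta>)"
    by (simp only: frag_cmul_cmul frag_cmul_distrib)
  then show ?thesis using mn diff_closed_add[OF diff_closed_B] diff_closed_cmul[OF diff_closed_B] by metis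
qed

section \<open>Coefficient functionals detecting the normal form of a chain\<close>

text \<open>Multiplicity of \<alpha> in the normal form: each \<open>[u i, u j]\<close> reduces to
  \<alpha> plus a multiple of \<delta>.\<close>

fun A_coeff :: "'a list \<Rightarrow> int" where
  "A_coeff [a, b] = of_bool (a \<in> range u \<and> b \<in> range u)"
| "A_coeff _ = 0"

fun E_coeff :: "int \<Rightarrow> 'a list \<Rightarrow> int" where
  "E_coeff i [a, b] = of_bool (a = u i \<and> b \<in> range v)"
| "E_coeff i _ = 0"

text \<open>Multiplicity of \<delta> in the normal form. An element determines its index only modulo
  \<open>m\<close> or \<open>n\<close>, and \<open>inv_into\<close> picks one; the value is
  therefore used only modulo \<open>gcd m n\<close>.\<close>

fun D_coeff :: "'a list \<Rightarrow> int" where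
  "D_coeff [a, b] = (if a \<in> range u then if b \<in> range u then inv_into UNIV u a - inv_into UNIV u b else inv_into UNIV v b else 0)"
| "D_coeff _ = 0"

lemma inv_u: "u (inv_into UNIV u (u i)) = u i" and inv_v: "v (inv_into UNIV v (v k)) = v k"
  by (simp_all add: f_inv_into_f)

lemma gcd_dvd_inv:
  "int (gcd m n) dvd inv_into UNIV u (u i) - i" "int (gcd m n) dvd inv_into UNIV v (v k) - k"
proof -
  have "int m dvd inv_into UNIV u (u i) - i" "int n dvd inv_into UNIV v (v k) - k"
    using inv_u[of i] inv_v[of k] by (simp_all add: u_eq_iff v_eq_iff mod_eq_dvd_iff)
  moreover have "int (gcd m n) dvd int m" "int (gcd m n) dvd int n" by simp_all
  ultimately show "int (gcd m n) dvd inv_into UNIV u (u i) - i" "int (gcd m n) dvd inv_into UNIV v (v k) - k"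
    using dvd_trans by blast+
qed

lemma boundary_coeffs:
  assumes "c \<in> carrier (rack_chains X 3)"
  shows "int_extend A_coeff (rack_boundary qop c) = 0 \<and> int_extend (E_coeff i) (rack_boundary qop c) = 0
    \<and> int (gcd m n) dvd int_extend D_coeff (rack_boundary qop c)"
proof -
  have "Poly_Mapping.keys c \<subseteq> {[a, b, c] | a b c. a \<in> X \<and> b \<in> X \<and> c \<in> X}"
    using assms by (simp add: rack_chains_3)
  then show ?thesis
  proof (rule free_Abelian_group_induct)
    fix xs assume "xs \<in> {[a, b, c] | a b c. a \<in> X \<and> b \<in> X \<and> c \<in> X}"
    then obtain a b c where xs: "xs = [a, b, c]" "a \<in> X" "b \<in> X" "c \<in> X" by blast
    have w: "int (gcd m n) dvd inv_into UNIV w (w k) - k" if "w = u \<or> w = v" for w k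
      using that gcd_dvd_inv by blast
    \<comment> \<open>In the boundary of a generator the true indices cancel. What remains are the
      errors between chosen and true indices, each divisible by the gcd.\<close>
    have D: "int (gcd m n) dvd s"
      if "s = (inv_into UNIV w (w k) - k) - (inv_into UNIV w (w l) - l) + ((inv_into UNIV w' (w' k') - k') - (inv_into UNIV w' (w' l') - l'))"
        "w = u \<or> w = v" "w' = u \<or> w' = v" for s w w' k l k' l'
      unfolding that(1)
      by (rule dvd_add[OF dvd_diff[OF w[OF that(2)] w[OF that(2)]] dvd_diff[OF w[OF that(3)] w[OF that(3)]]])
    show "int_extend A_coeff (rack_boundary qop (frag_of xs)) = 0
      \<and> int_extend (E_coeff i) (rack_boundary qop (frag_of xs)) = 0
      \<and> int (gcd m n) dvd int_extend D_coeff (rack_boundary qop (frag_of xs))"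
      using xs(2)
    proof (cases rule: X_cases)
      case (1 j)
      show ?thesis using xs(3)
      proof (cases rule: X_cases)
        case b: (1 k)
        show ?thesis using xs(4)
        proof (cases rule: X_cases)
          case (2 l)
          show ?thesis unfolding xs 1 b 2 rack_boundary_3
            by (auto intro!: D[of _ u j "j + 1" u "k + 1" k])
        qed (simp add: xs 1 b rack_boundary_3)
      next
        case b: (2 k)
        show ?thesis using xs(4)
        proof (cases rule: X_cases)
          case c: (1 l)
          show ?thesis unfolding xs 1 b c rack_boundary_3
            by (auto intro!: D[of _ u "j + 1" j v k "k + 1"])
        next
          case (2 l)
          show ?thesis unfolding xs 1 b 2 rack_boundary_3 by auto
        qed
      qed
    next
      case (2 j)
      then show ?thesis
        using xs(3,4) by (elim X_cases) (simp_all add: xs rack_boundary_3)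
    qed
  qed (auto simp: rack_boundary_diff)
qed

text \<open>Flow balance at the vertex \<open>u (i + 1)\<close>: the pairs \<open>[u i, v k]\<close>
  enter it and the pairs \<open>[u (i + 1), v k]\<close> leave it, while pairs within one orbit have
  boundary zero. For a cycle all these flows are thus equal.\<close>

lemma E_coeff_step:
  assumes "c \<in> carrier (rack_chains X 2)"
  shows "Poly_Mapping.lookup (rack_boundary qop c) [u (i + 1)]
    = int_extend (E_coeff i) c - int_extend (E_coeff (i + 1)) c"
proof -
  have "Poly_Mapping.keys c \<subseteq> {[a, b] | a b. a \<in> X \<and> b \<in> X}"
    using assms by (simp add: rack_chains_2)
  then show ?thesis
  proof (rule free_Abelian_group_induct)
    fix xs assume "xs \<in> {[a, b] | a b. a \<in> X \<and> b \<in> X}"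
    then obtain a b where xs: "xs = [a, b]" "a \<in> X" "b \<in> X" by blast
    have shift: "u (j + 1) = u (k + 1) \<longleftrightarrow> u j = u k" for j k
      by (simp add: u_eq_iff mod_eq_dvd_iff)
    show "Poly_Mapping.lookup (rack_boundary qop (frag_of xs)) [u (i + 1)]
      = int_extend (E_coeff i) (frag_of xs) - int_extend (E_coeff (i + 1)) (frag_of xs)"
      using xs(2,3)
      by (elim X_cases) (auto simp: xs rack_boundary_2 lookup_minus shift)
  qed (simp_all add: rack_boundary_diff lookup_minus)
qed

lemma E_coeff_const:
  assumes "c \<in> carrier (rack_chains X 2)" "rack_boundary qop c = 0"
  shows "int_extend (E_coeff i) c = int_extend (E_coeff 0) c"
proof (induction i rule: int_induct[of _ 0])
  case (step1 i)
  then show ?case using E_coeff_step[OF assms(1), of i] assms(2) by simp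
next
  case (step2 i)
  then show ?case using E_coeff_step[OF assms(1), of "i - 1"] assms(2) by simp
qed simp

text \<open>Projection onto the summand of the chain complex that belongs to the orbit
  \<open>range u\<close>.\<close>

definition u_part :: "('a list \<Rightarrow>\<^sub>0 int) \<Rightarrow> ('a list \<Rightarrow>\<^sub>0 int)" where
  "u_part = frag_extend (\<lambda>xs. if hd xs \<in> range u then frag_of xs else 0)"

lemma sum_E_coeff:
  "(\<Sum>j<m. frag_cmul (of_bool (u i = u (int j))) (frag_of [u (int j), v 0])) = frag_of [u i, v 0]"
proof -
  let ?j = "nat (i mod int m)"
  have j: "int ?j = i mod int m" "?j < m" using m_pos by (simp_all add: nat_less_iff)
  have mod: "u (i mod int m) = u i" by (simp add: u_eq_iff)
  have eq: "u i = u (int j) \<longleftrightarrow> j = ?j" if "j < m" for j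
    using that j by (auto simp: u_eq_iff)
  have "(\<Sum>j<m. frag_cmul (of_bool (u i = u (int j))) (frag_of [u (int j), v 0]))
      = (\<Sum>j<m. if j = ?j then frag_of [u i, v 0] else 0)"
    using eq by (intro sum.cong) (auto simp: mod)
  also have "\<dots> = frag_of [u i, v 0]" using j by simp
  finally show ?thesis .
qed

text \<open>On generators this is \<open>uu_normal\<close> or \<open>uv_normal\<close> at precisely
  the indices that \<open>inv_into\<close> chooses, so that \<open>D_coeff\<close> matches
  literally; both sides are linear in \<open>c\<close>.\<close>

lemma u_part_normal:
  assumes "c \<in> carrier (rack_chains X 2)"
  shows "u_part c - (frag_cmul (int_extend A_coeff c) \<alpha>
      + (\<Sum>j<m. frag_cmul (int_extend (E_coeff (int j)) c) (frag_of [u (int j), v 0]))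
      + frag_cmul (int_extend D_coeff c) \<delta>) \<in> B" (is "?P c")
proof -
  have "Poly_Mapping.keys c \<subseteq> {[a, b] | a b. a \<in> X \<and> b \<in> X}"
    using assms by (simp add: rack_chains_2)
  then show ?thesis
  proof (rule free_Abelian_group_induct[where P = ?P])
    show "?P 0" using diff_closed_0[OF diff_closed_B] by (simp add: u_part_def)
  next
    fix c d assume "?P c" "?P d"
    from diff_closed_diff[OF diff_closed_B this] show "?P (c - d)"
      by (simp add: u_part_def frag_extend_diff frag_cmul_diff_distrib sum_subtractf algebra_simps)
  next
    fix xs assume "xs \<in> {[a, b] | a b. a \<in> X \<and> b \<in> X}"
    then obtain a b where xs: "xs = [a, b]" "a \<in> X" "b \<in> X" by blast
    show "?P (frag_of xs)" using xs(2)
    proof (cases rule: X_cases)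
      case (1 i)
      show ?thesis using xs(3)
      proof (cases rule: X_cases)
        case b: (1 j)
        show ?thesis using uu_normal[of "inv_into UNIV u a" "inv_into UNIV u b"]
          unfolding xs 1 b by (simp add: u_part_def inv_u algebra_simps)
      next
        case (2 k)
        show ?thesis using uv_normal[of "inv_into UNIV u a" "inv_into UNIV v b"]
          unfolding xs 1 2 by (simp add: u_part_def inv_u inv_v sum_E_coeff algebra_simps)
      qed
    next
      case (2 k)
      then show ?thesis using diff_closed_0[OF diff_closed_B] by (simp add: xs u_part_def)
    qed
  qed
qed

text \<open>Injectivity half of the homology computation. On a cycle all \<open>E_coeff i\<close>
  agree with \<open>E_coeff 0\<close>, so only a multiple of \<delta> survives in the normal form,
  and it is a boundary by \<open>\<delta>_torsion\<close>.\<close>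

lemma u_part_boundary:
  assumes "c \<in> carrier (rack_chains X 2)" "rack_boundary qop c = 0"
    and "int_extend A_coeff c = 0" "int_extend (E_coeff 0) c = 0" "int (gcd m n) dvd int_extend D_coeff c"
  shows "u_part c \<in> B"
proof -
  have "u_part c - frag_cmul (int_extend D_coeff c) \<delta> \<in> B"
    using u_part_normal[OF assms(1)] E_coeff_const[OF assms(1,2)] assms(3,4) by simp
  from diff_closed_add[OF diff_closed_B this \<delta>_torsion[OF assms(5)]] show ?thesis by simp
qed

lemma D_coeff_\<delta>: "int (gcd m n) dvd int_extend D_coeff \<delta> - 1"
  using dvd_diff[OF gcd_dvd_inv(2)[of 1] gcd_dvd_inv(2)[of 0]] by (simp add: \<delta>_def algebra_simps)

text \<open>Surjectivity half. The witness combines \<alpha>, the full turn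
  \<open>?\<epsilon>\<close> along the cycle of \<open>u\<close>, whose boundary telescopes to zero,
  and \<delta>.\<close>

lemma cycle_with_coeffs:
  obtains c where "Poly_Mapping.keys c \<subseteq> {[a, b] | a b. a \<in> range u \<and> b \<in> X}" "rack_boundary qop c = 0"
    "int_extend A_coeff c = a" "int_extend (E_coeff 0) c = e" "int (gcd m n) dvd int_extend D_coeff c - d"
proof
  let ?S = "{[a, b] | a b. a \<in> range u \<and> b \<in> X}"
  let ?\<epsilon> = "\<Sum>j<m. frag_of [u (int j), v 0]"
  let ?c = "frag_cmul a \<alpha> + frag_cmul e ?\<epsilon> + frag_cmul d \<delta>"
  have mem: "?\<epsilon> \<in> carrier (free_Abelian_group ?S)"
    by (intro sum_closed_free_Abelian_group) auto
  have "diff_closed (carrier (free_Abelian_group ?S))"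
    using keys_diff by (fastforce simp: diff_closed_def)
  then have "?c \<in> carrier (free_Abelian_group ?S)"
    unfolding \<alpha>_def \<delta>_def using mem
    by (intro diff_closed_add diff_closed_cmul diff_closed_diff) auto
  then show "Poly_Mapping.keys ?c \<subseteq> ?S" by simp
  have "rack_boundary qop ?\<epsilon> = (\<Sum>j<m. frag_of [u (int (Suc j))] - frag_of [u (int j)])"
    by (induction m) (simp_all add: rack_boundary_add rack_boundary_2 add.commute)
  also have "\<dots> = frag_of [u (int m)] - frag_of [u 0]"
    by (subst sum_lessThan_telescope) simp
  also have "\<dots> = 0" using u_eq_iff[of "int m" 0] by simp
  finally show "rack_boundary qop ?c = 0"
    by (simp add: rack_boundary_add rack_boundary_cmul rack_boundary_diff rack_boundary_2 \<alpha>_def \<delta>_def)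
  show "int_extend A_coeff ?c = a"
    by (simp add: int_extend_sum \<alpha>_def \<delta>_def)
  have "int_extend (E_coeff 0) ?\<epsilon> = (\<Sum>j<m. if j = 0 then 1 else 0)"
    unfolding int_extend_sum by (intro sum.cong) (auto simp: u_eq_iff)
  then show "int_extend (E_coeff 0) ?c = e"
    using m_pos by (simp add: \<alpha>_def \<delta>_def)
  \<comment> \<open>The index chosen for \<open>v 0\<close> need not be \<open>0\<close>, so
    \<open>?\<epsilon>\<close> may contribute to \<open>D_coeff\<close>, though only a multiple of
    the gcd.\<close>
  have "int (gcd m n) dvd int_extend D_coeff ?\<epsilon>"
    using gcd_dvd_inv(2)[of 0] by (simp add: int_extend_sum)
  then have "int (gcd m n) dvd e * int_extend D_coeff ?\<epsilon> + d * (int_extend D_coeff \<delta> - 1)"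
    using D_coeff_\<delta> by (intro dvd_add dvd_mult)
  then show "int (gcd m n) dvd int_extend D_coeff ?c - d"
    by (simp add: \<alpha>_def algebra_simps)
qed

text \<open>\<open>D_coeff\<close> takes a value congruent to \<open>1\<close> on \<delta> and a
  value divisible by the gcd on boundaries, so no smaller multiple of \<delta> can be a
  boundary.\<close>

lemma \<delta>_mem_B_iff: "frag_cmul k \<delta> \<in> B \<longleftrightarrow> int (gcd m n) dvd k"
proof
  assume "frag_cmul k \<delta> \<in> B"
  then obtain c where c: "frag_cmul k \<delta> = rack_boundary qop c" "c \<in> carrier (orbit_chains X (range u) 3)"
    by blast
  then have "c \<in> carrier (rack_chains X 3)" by (auto simp: orbit_chains_3 rack_chains_3)
  then have "int (gcd m n) dvd int_extend D_coeff (frag_cmul k \<delta>)"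
    using boundary_coeffs c(1) by metis
  then have "int (gcd m n) dvd k * int_extend D_coeff \<delta>" by simp
  from dvd_diff[OF this dvd_mult[OF D_coeff_\<delta>, of k]] show "int (gcd m n) dvd k"
    by (simp add: algebra_simps)
qed (rule \<delta>_torsion)

lemma \<delta>_carrier: "frag_cmul k \<delta> \<in> carrier (orbit_chains X (range u) 2)"
proof -
  have "Poly_Mapping.keys \<delta> \<subseteq> {[a, b] | a b. a \<in> range u \<and> b \<in> X}"
    unfolding \<delta>_def by (rule order_trans[OF keys_diff]) auto
  then show ?thesis by (simp add: orbit_chains_2 order_trans[OF keys_cmul])
qed

section \<open>The torsion group of one orbit\<close>

abbreviation cls :: "('a list \<Rightarrow>\<^sub>0 int) \<Rightarrow> ('a list \<Rightarrow>\<^sub>0 int) set" where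
  "cls \<equiv> Q2_class X qop (range u)"

lemma qop_inv_simps: "qop_inv X qop (u i) (u j) = u i" "qop_inv X qop (u i) (v k) = u (i - 1)"
  using qop_inv_qop[of "u i" "u j"] qop_inv_qop[of "u (i - 1)" "v k"] by simp_all

lemma path_map_derived:
  "path_map X qop (u i) ` derived (structure_group X qop) (carrier (structure_group X qop))
    = range (\<lambda>k. cls (frag_cmul k \<delta>))" (is "?p ` ?D = _")
proof
  \<comment> \<open>The preimage of the cyclic group generated by the class of \<delta>; it contains
    the shifts required by \<open>derived_word\<close>.\<close>
  let ?N = "{c. \<exists>k. c - frag_cmul k \<delta> \<in> B}"
  have N: "diff_closed ?N"
    unfolding diff_closed_def
  proof (intro conjI ballI)
    show "0 \<in> ?N" using diff_closed_0[OF diff_closed_B] by (auto intro: exI[of _ 0])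
    fix x y assume "x \<in> ?N" "y \<in> ?N"
    then obtain k l where "x - frag_cmul k \<delta> \<in> B" "y - frag_cmul l \<delta> \<in> B" by auto
    from diff_closed_diff[OF diff_closed_B this] have "(x - y) - frag_cmul (k - l) \<delta> \<in> B"
      by (simp add: frag_cmul_diff_distrib algebra_simps)
    then show "x - y \<in> ?N" by blast
  qed
  have BN: "B \<subseteq> ?N" by (auto intro!: exI[of _ 0])
  have shift: "frag_of [a, qop b c] - frag_of [a, b] \<in> ?N"
    if a: "a \<in> X" "orbit a = range u" and b: "b \<in> X" and c: "c \<in> X" for a b c
  proof -
    obtain i where i: "a = u i" using orbit_self[OF a(1)] a(2) by auto
    have 0: "0 \<in> ?N" using diff_closed_0[OF N] .
    show ?thesis using b
    proof (cases rule: X_cases)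
      case (1 j)
      have "frag_of [u i, u (j + 1)] - frag_of [u i, u j] \<in> ?N"
        using uu_step2[of i j] by (auto intro!: exI[of _ "- 1"])
      then show ?thesis using c 0 by (elim X_cases) (simp_all add: i 1)
    next
      case (2 k)
      have "frag_of [u i, v (k + 1)] - frag_of [u i, v k] \<in> ?N"
        using uv_step[of i k] by (auto intro!: exI[of _ 1])
      then show ?thesis using c 0 by (elim X_cases) (simp_all add: i 2)
    qed
  qed
  show "?p ` ?D \<subseteq> range (\<lambda>k. cls (frag_cmul k \<delta>))"
  proof
    fix q assume "q \<in> ?p ` ?D"
    then obtain g where g: "g \<in> ?D" "q = ?p g" by blast
    obtain w where w: "w \<in> words X" "g = sclass w"
      "\<forall>a\<in>X. orbit a = range u \<longrightarrow> word_path a w \<in> ?N"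
      using derived_word[OF N BN shift g(1)] by blast
    have "word_path (u i) w \<in> ?N" by (rule w(3)[rule_format, OF in_X(1) orbit_u])
    then obtain k where k: "word_path (u i) w - frag_cmul k \<delta> \<in> B" by blast
    have "q = cls (word_path (u i) w)" using path_map_sclass[of "u i" w] w g by (simp add: orbit_u)
    also have "\<dots> = cls (frag_cmul k \<delta>)"
      using k w(1) word_path_carrier[of "u i" w] Q2_class_eq_iff[OF B_subset _ \<delta>_carrier]
      by (simp add: orbit_u)
    finally show "q \<in> range (\<lambda>k. cls (frag_cmul k \<delta>))" by blast
  qed
  \<comment> \<open>The commutator of the inverses of two generators, chosen to realise \<delta>
    with positive sign: from \<open>u i\<close> the two \<open>v 0\<close> letters cancel and leave
    \<open>[u i, u 0]\<close> minus \<open>[u (i - 1), u 0]\<close>.\<close>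
  let ?w = "[(v 0, False), (u 0, False), (v 0, True), (u 0, True)]"
  interpret G: group "structure_group X qop" by (rule group_structure_group)
  have D: "subgroup ?D (structure_group X qop)" by (intro G.derived_is_subgroup) simp
  have w: "?w \<in> words X" "word_act (u i) ?w = u i"
    by (simp_all add: qop_inv_simps)
  have path_w: "word_path (u i) ?w - \<delta> \<in> B"
    using uu_step1[of "i - 1" 0] by (simp add: qop_inv_simps)
  have wD: "sclass ?w \<in> ?D"
  proof -
    have "sclass ?w = sclass [(v 0, False)] \<otimes>\<^bsub>structure_group X qop\<^esub> sclass [(u 0, False)]
        \<otimes>\<^bsub>structure_group X qop\<^esub> inv\<^bsub>structure_group X qop\<^esub> sclass [(v 0, False)]
        \<otimes>\<^bsub>structure_group X qop\<^esub> inv\<^bsub>structure_group X qop\<^esub> sclass [(u 0, False)]"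
      by (simp add: sclass_inv sclass_mult inv_word_def)
    then show ?thesis
      unfolding derived_def using sclass_closed[of "[(v 0, False)]"] sclass_closed[of "[(u 0, False)]"]
      by (intro generate.incl) auto
  qed
  have inv_w: "word_act (u i) (inv_word ?w) = u i" "word_path (u i) (inv_word ?w) = - word_path (u i) ?w"
    by (simp_all add: inv_word_def qop_inv_simps)
  have inv_w_words: "inv_word ?w \<in> words X" by (simp add: inv_word_def)
  have inv_D: "sclass (inv_word ?w) \<in> ?D"
    using subgroup.m_inv_closed[OF D wD] sclass_inv[OF w(1)] by simp
  \<comment> \<open>Appending \<open>?w\<close> or its inverse word reaches every multiple of
    \<delta>; fixing \<open>u i\<close> is part of the invariant so that the paths add.\<close>
  have ex: "\<exists>w\<in>words X. sclass w \<in> ?D \<and> word_act (u i) w = u i \<and> word_path (u i) w - frag_cmul k \<delta> \<in> B" for k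
  proof (induction k rule: int_induct[of _ 0])
    case base
    then show ?case using subgroup.one_closed[OF D] diff_closed_0[OF diff_closed_B]
      by (intro bexI[of _ "[]"]) (simp_all add: structure_group_simps)
  next
    case (step1 k)
    then obtain w' where w': "w' \<in> words X" "sclass w' \<in> ?D" "word_act (u i) w' = u i"
      "word_path (u i) w' - frag_cmul k \<delta> \<in> B" by blast
    have "word_path (u i) (w' @ ?w) - frag_cmul (k + 1) \<delta> \<in> B"
      using diff_closed_add[OF diff_closed_B w'(4) path_w] w'(3)
      by (simp add: word_path_append frag_cmul_distrib algebra_simps del: word_path.simps)
    moreover have "sclass (w' @ ?w) \<in> ?D"
      using subgroup.m_closed[OF D w'(2) wD] w'(1) w(1) by (simp only: sclass_mult)
    moreover have "word_act (u i) (w' @ ?w) = u i" using w' w by (simp add: word_act_append)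
    moreover have "w' @ ?w \<in> words X" using w w' by simp
    ultimately show ?case by blast
  next
    case (step2 k)
    then obtain w' where w': "w' \<in> words X" "sclass w' \<in> ?D" "word_act (u i) w' = u i"
      "word_path (u i) w' - frag_cmul k \<delta> \<in> B" by blast
    have "word_path (u i) (w' @ inv_word ?w) - frag_cmul (k - 1) \<delta> \<in> B"
      using diff_closed_diff[OF diff_closed_B w'(4) path_w] w'(3) inv_w(2)
      by (simp add: word_path_append frag_cmul_diff_distrib algebra_simps del: word_path.simps)
    moreover have "sclass (w' @ inv_word ?w) \<in> ?D"
      using subgroup.m_closed[OF D w'(2) inv_D] w'(1) inv_w_words by (simp only: sclass_mult)
    moreover have "word_act (u i) (w' @ inv_word ?w) = u i" using w' inv_w by (simp add: word_act_append)
    moreover have "w' @ inv_word ?w \<in> words X" using inv_w_words w' by simp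
    ultimately show ?case by blast
  qed
  show "range (\<lambda>k. cls (frag_cmul k \<delta>)) \<subseteq> ?p ` ?D"
  proof safe
    fix k
    obtain w where w: "w \<in> words X" "sclass w \<in> ?D" "word_path (u i) w - frag_cmul k \<delta> \<in> B"
      using ex by blast
    have "?p (sclass w) = cls (word_path (u i) w)"
      using path_map_sclass[of "u i" w] w by (simp add: orbit_u)
    also have "\<dots> = cls (frag_cmul k \<delta>)"
      using w word_path_carrier[of "u i" w] Q2_class_eq_iff[OF B_subset _ \<delta>_carrier]
      by (simp add: orbit_u)
    finally show "cls (frag_cmul k \<delta>) \<in> ?p ` ?D" using w(2) by force
  qed
qed

text \<open>The carrier consists of the powers of the class of \<delta> by
  \<open>path_map_derived\<close>, and \<open>\<delta>_mem_B_iff\<close> gives the order. That the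
  record is a group is kept as a result because reversing an isomorphism out of it needs
  this.\<close>

lemma torsion_group_u:
  "group (torsion_group X qop (u i))"
  "torsion_group X qop (u i) \<cong> integer_mod_group (gcd m n)"
proof -
  let ?Q = "Q2_group X qop (range u)" and ?S = "range (\<lambda>k. cls (frag_cmul k \<delta>))"
  interpret Q: group ?Q by (rule group_Q2[OF B_subset])
  let ?d = "cls \<delta>"
  have d: "?d \<in> carrier ?Q" using \<delta>_carrier[of 1] by (simp add: carrier_Q2)
  have dS: "?d \<in> ?S" by (rule image_eqI[of _ _ 1]) simp_all
  have pow: "?d [^]\<^bsub>?Q\<^esub> k = cls (frag_cmul k \<delta>)" for k :: int
    using Q2_class_int_pow[OF B_subset \<delta>_carrier[of 1]] by simp
  have S: "subgroup ?S ?Q"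
  proof (rule Q.subgroupI)
    show "?S \<subseteq> carrier ?Q" using \<delta>_carrier by (auto simp only: carrier_Q2)
    show "inv\<^bsub>?Q\<^esub> x \<in> ?S" if "x \<in> ?S" for x
      using that Q2_class_inv[OF B_subset \<delta>_carrier] by (auto simp del: minus_frag_cmul) (metis minus_frag_cmul rangeI)
    show "x \<otimes>\<^bsub>?Q\<^esub> y \<in> ?S" if "x \<in> ?S" "y \<in> ?S" for x y
      using that Q2_class_mult[OF B_subset \<delta>_carrier \<delta>_carrier] by (auto simp flip: frag_cmul_distrib)
  qed simp
  let ?T = "?Q\<lparr>carrier := ?S\<rparr>"
  interpret T: group ?T using S by (rule Q.subgroup_imp_group)
  have powT: "?d [^]\<^bsub>?T\<^esub> k = cls (frag_cmul k \<delta>)" for k :: int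
    using Q.int_pow_consistent[OF S dS, of k] pow by simp
  have "?T \<cong> integer_mod_group (gcd m n)"
  proof (rule T.cyclic_iso_integer_mod_group)
    show "?d \<in> carrier ?T" using dS by simp
    show "carrier ?T = range (\<lambda>k::int. ?d [^]\<^bsub>?T\<^esub> k)" by (simp add: powT)
    fix k :: int
    have "0 \<in> carrier (orbit_chains X (range u) 2)" by (simp add: orbit_chains_def)
    then have "cls (frag_cmul k \<delta>) = cls 0 \<longleftrightarrow> frag_cmul k \<delta> \<in> B"
      using Q2_class_eq_iff[OF B_subset \<delta>_carrier, of 0 k] by simp
    then show "?d [^]\<^bsub>?T\<^esub> k = \<one>\<^bsub>?T\<^esub> \<longleftrightarrow> int (gcd m n) dvd k"
      unfolding powT by (simp add: Q2_class_one \<delta>_mem_B_iff)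
  qed
  moreover have "torsion_group X qop (u i) = ?T"
    by (simp add: torsion_group_def H2_summand_def Let_def path_map_derived orbit_u)
  ultimately show "torsion_group X qop (u i) \<cong> integer_mod_group (gcd m n)"
    "group (torsion_group X qop (u i))" using T.is_group by simp_all
qed

end

subsection \<open>The parameter group and the second homology group\<close>

lemma words_replicate: "s \<in> S \<Longrightarrow> replicate k (s, e) \<in> words S"
  by (auto simp: words_def)

lemma U_parameter_group_iso: "U_parameter_group m n \<cong> integer_mod_group (gcd m n)"
proof -
  define R :: "(nat word \<times> nat word) set" where
    "R = {(replicate m (1, True), []), (replicate n (2, True), []),
      ([(1, True), (2, True)], []), ([(1, True), (2, True)], [(2, True), (1, True)])}"
  define S :: "nat set" where "S = {1, 2}"
  have S_iff [simp]: "s \<in> S \<longleftrightarrow> s = 1 \<or> s = 2" for s by (simp add: S_def)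
  let ?P = "presented_group S R" and ?c = "pres_class S R"
  interpret P: group ?P by (rule group_presented_group)
  \<comment> \<open>Exponent of a letter as a power of the first generator: the second generator is
    its inverse, so \<open>(1, True)\<close> and \<open>(2, False)\<close> count \<open>1\<close>
    and the other two letters \<open>- 1\<close>.\<close>
  define letter :: "nat \<times> bool \<Rightarrow> int" where
    "letter l = (if (fst l = 1) = snd l then 1 else - 1)" for l
  define val where "val w = sum_list (map letter w)" for w
  have val_simps [simp]: "val [] = 0" "val (l # w) = letter l + val w" "val (w @ w') = val w + val w'"
    for l w w'
    by (simp_all add: val_def)
  have val_replicate [simp]: "val (replicate k l) = int k * letter l" for k l
    by (simp add: val_def sum_list_replicate)
  \<comment> \<open>The relations change the exponent only by \<open>m\<close>, \<open>n\<close> or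
    \<open>0\<close>, up to sign. This bounds the order from below, and \<open>pow_gcd\<close>
    bounds it from above.\<close>
  have invariant: "int (gcd m n) dvd val w - val w'" if "pres_eq S R w w'" for w w'
    using that
  proof (induction rule: pres_eq.induct)
    case (sym u v)
    then show ?case by (simp add: dvd_diff_commute)
  next
    case (trans u v w)
    from dvd_add[OF trans.IH] show ?case by simp
  next
    case (append u u' v v')
    from dvd_add[OF append.IH] show ?case by (simp add: algebra_simps)
  next
    case (rel u v)
    then show ?case by (auto simp: R_def letter_def)
  qed (auto simp: letter_def)
  have nil: "?c [] = \<one>\<^bsub>?P\<^esub>" by (simp add: presented_group_def)
  have car: "?c w \<in> carrier ?P" if "w \<in> words S" for w
    using that by (simp add: presented_group_def)
  have mult: "?c (l # w) = ?c [l] \<otimes>\<^bsub>?P\<^esub> ?c w" if "l # w \<in> words S" for l w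
    using mult_pres_class[of "[l]" S w R] that by (simp add: words_def)
  have eq: "?c w = ?c w'" if "pres_eq S R w w'" for w w'
    using that pres_class_eq_iff pres_eq_words by metis
  let ?a = "?c [(1, True)]"
  have letters: "?c [(s, e)] \<in> carrier ?P" if "s \<in> S" for s e
    using that by (intro car) (auto simp: words_def)
  have pair: "?c [x, y] = ?c [x] \<otimes>\<^bsub>?P\<^esub> ?c [y]" if "fst x \<in> S" "fst y \<in> S" for x y
    using mult[of x "[y]"] that by (cases x; cases y) (auto simp: words_def)
  have cancel: "?c [(s, e)] \<otimes>\<^bsub>?P\<^esub> ?c [(s, \<not> e)] = \<one>\<^bsub>?P\<^esub>" if "s \<in> S" for s e
    using eq[OF pres_eq.cancel[OF that, of R e]] pair[of "(s, e)" "(s, \<not> e)"] that nil by simp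
  have a: "?a \<in> carrier ?P" by (intro letters) simp
  have "?c [(1, False)] \<otimes>\<^bsub>?P\<^esub> ?a = \<one>\<^bsub>?P\<^esub>" using cancel[of 1 False] by simp
  then have c1F: "?c [(1, False)] = inv\<^bsub>?P\<^esub> ?a"
    using P.inv_equality[OF _ a letters[of 1 False]] by simp
  have "pres_eq S R [(1, True), (2, True)] []"
    by (rule pres_eq.rel) (auto simp: R_def words_def)
  then have "?a \<otimes>\<^bsub>?P\<^esub> ?c [(2, True)] = \<one>\<^bsub>?P\<^esub>"
    using eq pair[of "(1, True)" "(2, True)"] nil by simp
  then have a2: "inv\<^bsub>?P\<^esub> ?c [(2, True)] = ?a"
    using P.inv_equality[OF _ letters[of 2 True] a] by simp
  then have c2T: "?c [(2, True)] = inv\<^bsub>?P\<^esub> ?a"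
    using P.inv_inv[OF letters[of 2 True]] by simp
  have "?c [(2, False)] \<otimes>\<^bsub>?P\<^esub> ?c [(2, True)] = \<one>\<^bsub>?P\<^esub>" using cancel[of 2 False] by simp
  then have c2F: "?c [(2, False)] = ?a"
    using P.inv_equality[OF _ letters[of 2 True] letters[of 2 False]] a2 by simp
  have unit_pows: "?a [^]\<^bsub>?P\<^esub> (1 :: int) = ?a" "?a [^]\<^bsub>?P\<^esub> (- 1 :: int) = inv\<^bsub>?P\<^esub> ?a"
    using a P.int_pow_neg[OF a, of 1] by simp_all
  have class_eq: "?c w = ?a [^]\<^bsub>?P\<^esub> val w" if "w \<in> words S" for w
    using that
  proof (induction w)
    case Nil
    then show ?case using nil by simp
  next
    case (Cons l w)
    have lw: "fst l \<in> S" "w \<in> words S" using Cons.prems by (auto simp: words_def)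
    have "?c [l] = ?a [^]\<^bsub>?P\<^esub> letter l"
      using lw(1) c1F c2T c2F unit_pows
      by (cases l; cases "snd l") (auto simp: letter_def)
    then show ?case
      using mult[OF Cons.prems] Cons.IH[OF lw(2)] a by (simp add: P.int_pow_mult)
  qed
  have "?a [^]\<^bsub>?P\<^esub> int m = \<one>\<^bsub>?P\<^esub>"
  proof -
    have "pres_eq S R (replicate m (1, True)) []"
      by (rule pres_eq.rel) (auto simp: R_def words_def)
    then show ?thesis
      using eq nil class_eq[OF words_replicate[of 1 S m True]] by (simp add: letter_def)
  qed
  then have a_m: "?a [^]\<^bsub>?P\<^esub> (int m * i) = \<one>\<^bsub>?P\<^esub>" for i
    using P.int_pow_pow[OF a] by (metis P.int_pow_one)
  have "?a [^]\<^bsub>?P\<^esub> (- int n) = \<one>\<^bsub>?P\<^esub>"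
  proof -
    have "pres_eq S R (replicate n (2, True)) []"
      by (rule pres_eq.rel) (auto simp: R_def words_def)
    then show ?thesis
      using eq nil class_eq[OF words_replicate[of 2 S n True]] by (simp add: letter_def)
  qed
  then have a_n: "?a [^]\<^bsub>?P\<^esub> (int n * i) = \<one>\<^bsub>?P\<^esub>" for i
    using P.int_pow_pow[OF a, of "- int n" "- i"] by simp
  have pow_gcd: "?a [^]\<^bsub>?P\<^esub> k = \<one>\<^bsub>?P\<^esub>" if gk: "int (gcd m n) dvd k" for k
  proof -
    obtain x y where "x * int m + y * int n = int (gcd m n)"
      using bezout_int[of "int m" "int n"] by auto
    moreover obtain q where "k = int (gcd m n) * q" using gk by blast
    ultimately have "k = (x * int m + y * int n) * q" by simp
    then have "k = int m * (x * q) + int n * (y * q)" by (simp add: algebra_simps)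
    then show ?thesis
      using P.int_pow_mult[OF a, of "int m * (x * q)" "int n * (y * q)"] a_m a_n by simp
  qed
  have "?P \<cong> integer_mod_group (gcd m n)"
  proof (rule P.cyclic_iso_integer_mod_group[OF a])
    show "carrier ?P = range (\<lambda>k::int. ?a [^]\<^bsub>?P\<^esub> k)"
    proof
      show "carrier ?P \<subseteq> range (\<lambda>k::int. ?a [^]\<^bsub>?P\<^esub> k)"
      proof
        fix g assume "g \<in> carrier ?P"
        then obtain w where "w \<in> words S" "g = ?c w" by (auto simp: presented_group_def)
        then show "g \<in> range (\<lambda>k::int. ?a [^]\<^bsub>?P\<^esub> k)" using class_eq[of w] by blast
      qed
      show "range (\<lambda>k::int. ?a [^]\<^bsub>?P\<^esub> k) \<subseteq> carrier ?P" using a by auto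
    qed
  next
    fix k :: int
    \<comment> \<open>A word with exponent exactly \<open>k\<close>; the Boolean carries the sign of
      \<open>k\<close>.\<close>
    let ?w = "replicate (nat \<bar>k\<bar>) (1, 0 \<le> k)"
    have w: "?w \<in> words S" by (rule words_replicate) simp
    have val_w: "val ?w = k" by (simp add: letter_def)
    show "?a [^]\<^bsub>?P\<^esub> k = \<one>\<^bsub>?P\<^esub> \<longleftrightarrow> int (gcd m n) dvd k"
    proof
      assume "?a [^]\<^bsub>?P\<^esub> k = \<one>\<^bsub>?P\<^esub>"
      then have "?c ?w = ?c []" using class_eq[OF w] val_w nil by simp
      then have "pres_eq S R ?w []" using pres_class_eq_iff[OF w] by blast
      from invariant[OF this] val_w show "int (gcd m n) dvd k" by simp
    next
      assume "int (gcd m n) dvd k"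
      then show "?a [^]\<^bsub>?P\<^esub> k = \<one>\<^bsub>?P\<^esub>"
        by (rule pow_gcd)
    qed
  qed
  then show ?thesis by (simp add: U_parameter_group_def R_def S_def)
qed

section \<open>The second homology group\<close>

text \<open>First isomorphism theorem for the map from cycles given by three functionals per orbit.
  Only \<open>E_coeff 0\<close> is recorded, since on cycles the other \<open>E_coeff i\<close> have
  the same value.\<close>

lemma rack_homology_iso:
  assumes "two_cycles X qop m n u v" "two_cycles X qop n m v u"
  shows "rack_homology X qop 2 \<cong> integer_group \<times>\<times> integer_group \<times>\<times> integer_group \<times>\<times> integer_group \<times>\<times>
           integer_mod_group (gcd m n) \<times>\<times> integer_mod_group (gcd m n)"
proof -
  interpret U: two_cycles X qop m n u v by (rule assms(1))
  interpret V: two_cycles X qop n m v u by (rule assms(2))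
  let ?C1 = "rack_chains X 1" and ?C2 = "rack_chains X 2" and ?C3 = "rack_chains X 3"
  let ?d = "rack_boundary qop"
  let ?K = "?C2\<lparr>carrier := kernel ?C2 ?C1 ?d\<rparr>"
  let ?g = "gcd m n"
  let ?H = "integer_group \<times>\<times> integer_group \<times>\<times> integer_group \<times>\<times> integer_group \<times>\<times>
           integer_mod_group ?g \<times>\<times> integer_mod_group ?g"
  let ?\<Phi> = "\<lambda>c. (int_extend U.A_coeff c, int_extend (U.E_coeff 0) c,
      int_extend V.A_coeff c, int_extend (V.E_coeff 0) c,
      int_extend U.D_coeff c mod int ?g, int_extend V.D_coeff c mod int ?g)"
  have g: "?g \<noteq> 0" using U.m_pos by simp
  have one_C1: "\<one>\<^bsub>rack_chains X (Suc 0)\<^esub> = 0" by (simp add: rack_chains_1)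
  have kerD: "c \<in> carrier ?K \<longleftrightarrow> c \<in> carrier ?C2 \<and> ?d c = 0" for c
    by (simp add: kernel_def rack_chains_def)
  have d_hom: "?d \<in> hom ?C2 ?C1"
  proof (rule homI)
    fix c assume "c \<in> carrier ?C2"
    then have "Poly_Mapping.keys c \<subseteq> {[a, b] | a b. a \<in> X \<and> b \<in> X}" by (simp add: rack_chains_2)
    moreover have "Poly_Mapping.keys (?d (frag_of [a, b])) \<subseteq> {[a] | a. a \<in> X}" if "a \<in> X" "b \<in> X" for a b
      unfolding rack_boundary_2 using that U.qop_closed
      by (intro order_trans[OF keys_diff]) (auto simp: keys_frag_of)
    ultimately have "Poly_Mapping.keys (?d c) \<subseteq> {[a] | a. a \<in> X}"
      by (intro order_trans[OF keys_rack_boundary]) blast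
    then show "?d c \<in> carrier ?C1" by (simp add: rack_chains_1)
  qed (simp add: rack_chains_def rack_boundary_add)
  interpret d: group_hom ?C2 ?C1 ?d
    using d_hom by (simp add: group_hom_def group_hom_axioms_def rack_chains_def)
  have K: "group ?K"
    using d.subgroup_kernel by (rule d.G.subgroup_imp_group)
  have H: "group ?H" by (intro DirProd_group) simp_all
  have "?\<Phi> \<in> hom ?K ?H"
    using g by (intro homI) (auto simp: DirProd_def carrier_integer_mod_group rack_chains_def mod_add_eq)
  then interpret \<Phi>: group_hom ?K ?H ?\<Phi>
    using K H by (simp add: group_hom_def group_hom_axioms_def)
  have surj: "?\<Phi> ` carrier ?K = carrier ?H"
  proof
    show "?\<Phi> ` carrier ?K \<subseteq> carrier ?H" using \<Phi>.hom_closed by blast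
    show "carrier ?H \<subseteq> ?\<Phi> ` carrier ?K"
    proof
      fix h assume "h \<in> carrier ?H"
      then obtain a1 e1 a2 e2 d1 d2 where h: "h = (a1, e1, a2, e2, d1, d2)"
        "d1 \<in> {0..<int ?g}" "d2 \<in> {0..<int ?g}"
        using g by (auto simp: DirProd_def carrier_integer_mod_group)
      obtain c1 where c1: "Poly_Mapping.keys c1 \<subseteq> {[a, b] | a b. a \<in> range u \<and> b \<in> X}" "?d c1 = 0"
        "int_extend U.A_coeff c1 = a1" "int_extend (U.E_coeff 0) c1 = e1"
        "int ?g dvd int_extend U.D_coeff c1 - d1"
        by (rule U.cycle_with_coeffs)
      obtain c2 where c2: "Poly_Mapping.keys c2 \<subseteq> {[a, b] | a b. a \<in> range v \<and> b \<in> X}" "?d c2 = 0"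
        "int_extend V.A_coeff c2 = a2" "int_extend (V.E_coeff 0) c2 = e2"
        "int ?g dvd int_extend V.D_coeff c2 - d2"
        by (rule V.cycle_with_coeffs[unfolded gcd.commute[of n m]])
      \<comment> \<open>The functionals of one orbit vanish on chains supported over the other, so
        \<open>c1\<close> and \<open>c2\<close> can be prescribed independently and added.\<close>
      have V_coeffs: "V.A_coeff xs = 0 \<and> V.E_coeff 0 xs = 0 \<and> V.D_coeff xs = 0"
        if "xs \<in> {[a, b] | a b. a \<in> range u \<and> b \<in> X}" for xs
        using that by auto
      have U_coeffs: "U.A_coeff xs = 0 \<and> U.E_coeff 0 xs = 0 \<and> U.D_coeff xs = 0"
        if "xs \<in> {[a, b] | a b. a \<in> range v \<and> b \<in> X}" for xs
        using that by auto
      have c1V: "int_extend V.A_coeff c1 = 0" "int_extend (V.E_coeff 0) c1 = 0" "int_extend V.D_coeff c1 = 0"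
        using V_coeffs subsetD[OF c1(1)] by (simp_all add: int_extend_eq_0)
      have c2U: "int_extend U.A_coeff c2 = 0" "int_extend (U.E_coeff 0) c2 = 0" "int_extend U.D_coeff c2 = 0"
        using U_coeffs subsetD[OF c2(1)] by (simp_all add: int_extend_eq_0)
      have "c1 + c2 \<in> carrier ?C2"
      proof -
        have "Poly_Mapping.keys c1 \<subseteq> {[a, b] | a b. a \<in> X \<and> b \<in> X}"
          "Poly_Mapping.keys c2 \<subseteq> {[a, b] | a b. a \<in> X \<and> b \<in> X}"
          using U.X_eq by (auto intro!: order_trans[OF c1(1)] order_trans[OF c2(1)])
        then show ?thesis by (simp add: rack_chains_2 order_trans[OF keys_add])
      qed
      then have mem: "c1 + c2 \<in> carrier ?K" using c1(2) c2(2) unfolding kerD by (simp add: rack_boundary_add)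
      have "int_extend U.D_coeff c1 mod int ?g = d1" "int_extend V.D_coeff c2 mod int ?g = d2"
        using c1(5) c2(5) h(2,3) by (simp_all flip: mod_eq_dvd_iff)
      then have "?\<Phi> (c1 + c2) = h"
        using c1 c2 c1V c2U h by simp
      then show "h \<in> ?\<Phi> ` carrier ?K" using mem by blast
    qed
  qed
  have ker: "kernel ?K ?H ?\<Phi> = ?d ` carrier ?C3"
  proof
    \<comment> \<open>The splitting of the complex over the two orbits; each half is then shown to
      be a boundary by \<open>u_part_boundary\<close> for its own cycle.\<close>
    have split: "c = U.u_part c + V.u_part c" if "c \<in> carrier ?C2" for c
    proof -
      have "Poly_Mapping.keys c \<subseteq> {[a, b] | a b. a \<in> X \<and> b \<in> X}"
        using that by (simp add: rack_chains_2)
      then show ?thesis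
      proof (rule free_Abelian_group_induct)
        fix x y assume "x = U.u_part x + V.u_part x" "y = U.u_part y + V.u_part y"
        then show "x - y = U.u_part (x - y) + V.u_part (x - y)"
          by (simp add: U.u_part_def V.u_part_def frag_extend_diff algebra_simps)
      qed (auto simp: U.u_part_def V.u_part_def U.X_eq)
    qed
    have B: "U.boundaries Y \<subseteq> ?d ` carrier ?C3" if "Y \<subseteq> X" for Y
    proof (intro image_mono subsetI)
      have "{[a, b, c] | a b c. a \<in> Y \<and> b \<in> X \<and> c \<in> X} \<subseteq> {[a, b, c] | a b c. a \<in> X \<and> b \<in> X \<and> c \<in> X}"
        using that by blast
      then show "c \<in> carrier ?C3" if "c \<in> carrier (orbit_chains X Y 3)" for c
        using that by (simp add: orbit_chains_3 rack_chains_3)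
    qed
    show "kernel ?K ?H ?\<Phi> \<subseteq> ?d ` carrier ?C3"
    proof
      fix c assume "c \<in> kernel ?K ?H ?\<Phi>"
      then have c: "c \<in> carrier ?C2" "?d c = 0" "int_extend U.A_coeff c = 0" "int_extend (U.E_coeff 0) c = 0"
        "int ?g dvd int_extend U.D_coeff c" "int_extend V.A_coeff c = 0" "int_extend (V.E_coeff 0) c = 0"
        "int (gcd n m) dvd int_extend V.D_coeff c"
        unfolding kernel_def by (auto simp: DirProd_def gcd.commute one_C1)
      have "U.u_part c \<in> ?d ` carrier ?C3" "V.u_part c \<in> ?d ` carrier ?C3"
        using U.u_part_boundary[OF c(1-5)] V.u_part_boundary[OF c(1,2,6-8)]
          B[of "range u"] B[of "range v"] U.X_eq by blast+
      moreover have "diff_closed (?d ` carrier ?C3)"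
        unfolding rack_chains_def by (rule diff_closed_boundary_image)
      ultimately show "c \<in> ?d ` carrier ?C3"
        using split[OF c(1)] diff_closed_add by metis
    qed
    show "?d ` carrier ?C3 \<subseteq> kernel ?K ?H ?\<Phi>"
    proof safe
      fix c assume c: "c \<in> carrier ?C3"
      have keys: "Poly_Mapping.keys c \<subseteq> {[x, y, z] | x y z. x \<in> X \<and> y \<in> X \<and> z \<in> X}"
        using c by (simp add: rack_chains_3)
      have "U.boundaries X \<subseteq> carrier ?C2"
        using U.boundaries_subset[of X] U.qop_closed by (simp add: orbit_chains_2 rack_chains_2)
      then have 1: "?d c \<in> carrier ?C2"
        using c by (auto simp: orbit_chains_3 rack_chains_3)
      have 2: "?d (?d c) = 0"
        using keys
      proof (rule free_Abelian_group_induct)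
        fix xs assume "xs \<in> {[x, y, z] | x y z. x \<in> X \<and> y \<in> X \<and> z \<in> X}"
        then obtain x y z where xs: "xs = [x, y, z]" "x \<in> X" "y \<in> X" "z \<in> X" by blast
        then show "?d (?d (frag_of xs)) = 0"
          using U.self_distrib[of x y z]
          by (simp add: rack_boundary_3 rack_boundary_2 rack_boundary_add rack_boundary_diff)
      qed (simp_all add: rack_boundary_diff)
      show "?d c \<in> kernel ?K ?H ?\<Phi>"
        using 1 2 U.boundary_coeffs[OF c, of 0] V.boundary_coeffs[OF c, of 0]
        unfolding kernel_def by (simp add: DirProd_def gcd.commute one_C1)
    qed
  qed
  have "?K Mod (kernel ?K ?H ?\<Phi>) \<cong> ?H"
    using \<Phi>.FactGroup_iso[OF surj] .
  then show ?thesis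
    unfolding ker by (simp add: rack_homology_def)
qed

section \<open>The quandle \<open>U_set m n\<close> as a pair of rotating cycles\<close>

text \<open>Reading an integer index modulo the cycle length turns the modular successor in
  \<open>U_op\<close> into \<open>i + 1\<close>. Both orders of the cycles are provided, one for
  each orbit.\<close>

lemma two_cycles_U:
  assumes "m \<ge> 1" "n \<ge> 1"
  defines "u \<equiv> \<lambda>i. Inl (nat (i mod int m))" and "v \<equiv> \<lambda>k. Inr (nat (k mod int n))"
  shows "two_cycles (U_set m n) (U_op m n) m n u v" "two_cycles (U_set m n) (U_op m n) n m v u"
    and "range u = U_orbit1 m" "range v = U_orbit2 n"
proof -
  have range: "range (\<lambda>i. nat (i mod int p)) = {..<p}" if "p \<ge> 1" for p :: nat
  proof
    show "range (\<lambda>i. nat (i mod int p)) \<subseteq> {..<p}" using that by (auto simp: nat_less_iff)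
    show "{..<p} \<subseteq> range (\<lambda>i. nat (i mod int p))"
    proof
      fix i assume "i \<in> {..<p}"
      then have "i = nat (int i mod int p)" by (simp flip: of_nat_mod)
      then show "i \<in> range (\<lambda>i. nat (i mod int p))" by blast
    qed
  qed
  show ranges: "range u = U_orbit1 m" "range v = U_orbit2 n"
    using range[OF assms(1)] range[OF assms(2)] unfolding u_def v_def U_orbit1_def U_orbit2_def
    by (metis image_image)+
  have X: "U_set m n = range u \<union> range v" by (simp add: ranges U_set_def)
  have eq: "nat (i mod int p) = nat (j mod int p) \<longleftrightarrow> i mod int p = j mod int p" if "p \<ge> 1" for i j p
    using that by (simp add: nat_eq_iff)
  have suc: "(nat (i mod int p) + 1) mod p = nat ((i + 1) mod int p)" if "p \<ge> 1" for i p
  proof -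
    have "nat ((i + 1) mod int p) = nat ((i mod int p + 1) mod int p)" by (simp only: mod_add_left_eq)
    also have "\<dots> = nat (int (nat (i mod int p) + 1) mod int p)" using that by (simp add: add.commute)
    also have "\<dots> = (nat (i mod int p) + 1) mod p" by (simp only: nat_int flip: of_nat_mod)
    finally show ?thesis ..
  qed
  interpret abelian_quandle "U_set m n" "U_op m n" by (rule U_abelian_quandle[OF assms(1,2)])
  have orbits: "quandle_orbit (U_set m n) (U_op m n) (u i) = range u"
    "quandle_orbit (U_set m n) (U_op m n) (v k) = range v" for i k
    using U_orbits[OF assms(1,2)] by (metis rangeI ranges)+
  show "two_cycles (U_set m n) (U_op m n) m n u v"
    by unfold_locales (use X assms(1,2) orbits in \<open>auto simp: u_def v_def eq suc[simplified]\<close>)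
  show "two_cycles (U_set m n) (U_op m n) n m v u"
    by unfold_locales (use X assms(1,2) orbits in \<open>auto simp: u_def v_def eq suc[simplified]\<close>)
qed

theorem proposition8p1:
  fixes m n :: nat
  assumes "m \<ge> 1" and "n \<ge> 1"
  shows "rack_homology (U_set m n) (U_op m n) 2 \<cong>
           integer_group \<times>\<times> integer_group \<times>\<times> integer_group \<times>\<times> integer_group \<times>\<times>
           integer_mod_group (gcd m n) \<times>\<times> integer_mod_group (gcd m n)
         \<and> (\<forall>a \<in> U_orbit1 m. \<forall>b \<in> U_orbit2 n.
              torsion_group (U_set m n) (U_op m n) a \<cong> torsion_group (U_set m n) (U_op m n) b
            \<and> torsion_group (U_set m n) (U_op m n) a \<cong> U_parameter_group m n
            \<and> torsion_group (U_set m n) (U_op m n) b \<cong> U_parameter_group m n)"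
proof (intro conjI ballI)
  note cycles = two_cycles_U[OF assms]
  show "rack_homology (U_set m n) (U_op m n) 2 \<cong>
           integer_group \<times>\<times> integer_group \<times>\<times> integer_group \<times>\<times> integer_group \<times>\<times>
           integer_mod_group (gcd m n) \<times>\<times> integer_mod_group (gcd m n)"
    by (rule rack_homology_iso[OF cycles(1,2)])
  have "group (U_parameter_group m n)"
    unfolding U_parameter_group_def by (rule group_presented_group)
  then have param: "integer_mod_group (gcd m n) \<cong> U_parameter_group m n"
    using group.iso_sym U_parameter_group_iso by blast
  fix a b assume "a \<in> U_orbit1 m" "b \<in> U_orbit2 n"
  then have a: "torsion_group (U_set m n) (U_op m n) a \<cong> integer_mod_group (gcd m n)"
    and b: "torsion_group (U_set m n) (U_op m n) b \<cong> integer_mod_group (gcd m n)"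
    using two_cycles.torsion_group_u(2)[OF cycles(1)] two_cycles.torsion_group_u(2)[OF cycles(2)]
    unfolding cycles(3,4)[symmetric] by (auto simp: gcd.commute)
  show "torsion_group (U_set m n) (U_op m n) a \<cong> U_parameter_group m n"
    using iso_trans[OF a param] .
  show "torsion_group (U_set m n) (U_op m n) b \<cong> U_parameter_group m n"
    using iso_trans[OF b param] .
  have "group (torsion_group (U_set m n) (U_op m n) b)"
    using \<open>b \<in> U_orbit2 n\<close> two_cycles.torsion_group_u(1)[OF cycles(2)]
    unfolding cycles(4)[symmetric] by auto
  then show "torsion_group (U_set m n) (U_op m n) a \<cong> torsion_group (U_set m n) (U_op m n) b"
    using iso_trans[OF a group.iso_sym[OF _ b]] by blast
qed

end
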